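(* Let $C$ be a plane projective curve of degree $d$. Let $(n_1,\dots,n_k)\in\mathbb{N}^k$, and let $\tilde C=T_{(n_1,\dots,n_k)}(C)$. Then the degree of the resulting curve $\tilde C$ is $d(n_1+\cdots+n_k+1)$.
   Context: Curves are complex plane projective curves and $\mathbb{N}=\{1,2,3,\dots\}$. The Hirzebruch surface $F_n$ is the $\mathbb{P}^1$-bundle over $\mathbb{P}^1$ whose exceptional section has self-intersection $-n$. Elementary transformations: the first type ($F_n$ to $F_{n+1}$) blows up a point on the exceptional section and then blows down the proper transform of the fiber through that point. The second type ($F_n$ to $F_{n-1}$) blows up a point on a fiber $Q$, outside the exceptional section, and then blows down the proper transform of $Q$. In both cases the transformation is said to be performed on that fiber; the new fiber (the exceptional curve of the blow-up) replaces the old one and is called its proper transform. Construction of $T_{(n_1,\dots,n_k)}$: take $k$ different lines $Q_1,\dots,Q_k$, all meeting $C$ transversally and intersecting in a point $O$ outside $C$, in such a way that, for a disk $D$ centered at $O$, the intersection points of the lines with the boundary of $D$ are organized counterclockwise. An additional line $P$ also passes through $O$ and intersects $C$ transversally. Blow up $O$ to get $F_1$. Apply $n_i$ elementary transformations of the first type on the proper transform of $Q_i$ for all $i$, reaching $F_{(\sum n_i)+1}$. Then apply $\sum n_i$ elementary transformations of the second type on the proper transform of $P$, returning to $F_1$. Finally blow down the exceptional section to get $\mathbb{P}^2$. This defines the Cremona transformation $T_{(n_1,\dots,n_k)}$; the image of $C$ is its proper transform.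
   Formalization: The point blown up by the first elementary transformation of the second type on P is required to lie off the proper transform of C; the construction allows any point outside the exceptional section, but if it lies on the curve the degree always drops and the claim fails. *)

theory Defs
  imports
    "HOL-Analysis.Analysis"
    "HOL-Library.Poly_Mapping"
    "HOL-Computational_Algebra.Squarefree"
begin

section \<open>Polynomials and plane projective curves\<close>

text \<open>Polynomials over the complex numbers in variables indexed by a finite type: finitely
  supported maps from exponent vectors to coefficients, with the convolution product.\<close>

type_synonym 'v cpoly = "('v \<Rightarrow>\<^sub>0 nat) \<Rightarrow>\<^sub>0 complex"

definition peval :: "'v::finite cpoly \<Rightarrow> complex^'v \<Rightarrow> complex" where
  "peval F x = (\<Sum>m\<in>Poly_Mapping.keys F.
     Poly_Mapping.lookup F m * (\<Prod>i\<in>UNIV. x $ i ^ Poly_Mapping.lookup m i))"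

definition homogeneous :: "nat \<Rightarrow> 'v::finite cpoly \<Rightarrow> bool" where
  "homogeneous d F \<longleftrightarrow> (\<forall>m\<in>Poly_Mapping.keys F. (\<Sum>i\<in>UNIV. Poly_Mapping.lookup m i) = d)"

text \<open>A point of the projective plane is the set of its homogeneous coordinate vectors.\<close>

type_synonym point2 = "(complex^3) set"

definition pt :: "complex^3 \<Rightarrow> point2" where
  "pt v = {c *s v | c. c \<noteq> 0}"

text \<open>\<open>C\<close> is the zero set of \<open>F\<close>, and \<open>F\<close> is a reduced equation, so that its degree \<open>d\<close> is the
  degree of the (reduced, possibly reducible) curve \<open>C\<close>.\<close>

definition reduced_equation :: "nat \<Rightarrow> 3 cpoly \<Rightarrow> point2 set \<Rightarrow> bool" where
  "reduced_equation d F C \<longleftrightarrow>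
     1 \<le> d \<and> homogeneous d F \<and> squarefree F \<and> C = {pt v | v. v \<noteq> 0 \<and> peval F v = 0}"

definition plane_curve_of_degree :: "point2 set \<Rightarrow> nat \<Rightarrow> bool" where
  "plane_curve_of_degree C d \<longleftrightarrow> (\<exists>F. reduced_equation d F C)"

text \<open>At every common point the differential of the reduced equation of \<open>C\<close> does not vanish along
  the line \<open>L\<close>: the curve is smooth there and \<open>L\<close> is not its tangent.\<close>

definition meets_transversally :: "point2 set \<Rightarrow> point2 set \<Rightarrow> bool" where
  "meets_transversally L C \<longleftrightarrow> (\<exists>d F. reduced_equation d F C \<and>
     (\<forall>v w. v \<noteq> 0 \<longrightarrow> w \<noteq> 0 \<longrightarrow> pt v \<in> L \<inter> C \<longrightarrow> pt w \<in> L \<longrightarrow> pt w \<noteq> pt v \<longrightarrow>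
        deriv (\<lambda>t. peval F (v + t *s w)) 0 \<noteq> 0))"

definition zariski_closure :: "point2 set \<Rightarrow> point2 set" where
  "zariski_closure S = {pt v | v. v \<noteq> 0 \<and>
     (\<forall>d F. homogeneous d F \<and> (\<forall>w. pt w \<in> S \<longrightarrow> peval F w = 0) \<longrightarrow> peval F v = 0)}"


section \<open>Hirzebruch surfaces\<close>

text \<open>\<open>F\<^sub>n\<close> is the quotient of the coordinate tuples \<open>(x, u, v)\<close>, with \<open>x = (x\<^sub>1, x\<^sub>2) \<noteq> 0\<close> and
  \<open>(u, v) \<noteq> 0\<close>, by the action \<open>(x, u, v) \<mapsto> (c x, e c\<^sup>-\<^sup>n u, e v)\<close> of pairs of nonzero scalars. It is a
  \<open>P\<^sup>1\<close>-bundle over \<open>P\<^sup>1\<close> by \<open>(x, u, v) \<mapsto> x\<close>. The exceptional section is \<open>u = 0\<close>: in the charts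
  \<open>x\<^sub>1 = v = 1\<close> and \<open>x\<^sub>2 = v = 1\<close> its normal coordinates \<open>u\<close> differ by the factor \<open>(x\<^sub>2 / x\<^sub>1)\<^sup>n\<close>, so its
  normal bundle is \<open>O(-n)\<close> and its self-intersection is \<open>-n\<close>.\<close>

type_synonym coord = "(complex^2) \<times> complex \<times> complex"
type_synonym fpoint = "coord set"

definition hpt :: "nat \<Rightarrow> coord \<Rightarrow> fpoint" where
  "hpt n = (\<lambda>(x, u, v). {(c *s x, e * u / c ^ n, e * v) | c e. c \<noteq> 0 \<and> e \<noteq> 0})"

definition hcoord :: "coord set" where
  "hcoord = {(x, u, v). x \<noteq> 0 \<and> (u, v) \<noteq> (0, 0)}"

definition hirzebruch :: "nat \<Rightarrow> fpoint set" where
  "hirzebruch n = hpt n ` hcoord"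

text \<open>The linear form on the base whose only zero is the base point \<open>q\<close>; thus \<open>fib q x = 0\<close> is the
  equation of the fibre over \<open>q\<close> on every \<open>F\<^sub>n\<close>.\<close>

definition fib :: "complex^2 \<Rightarrow> complex^2 \<Rightarrow> complex" where
  "fib q x = q $ 1 * x $ 2 - q $ 2 * x $ 1"


section \<open>Elementary transformations\<close>

text \<open>The point \<open>fib q = s = 0\<close>, where \<open>s\<close> is a section equation, is blown up by adjoining a point
  \<open>(a : b)\<close> of \<open>P\<^sup>1\<close> with \<open>a s = b fib q\<close>. Over the centre \<open>(a : b)\<close> is arbitrary (exceptional curve);
  the proper transform of the fibre \<open>fib q = 0\<close> is \<open>a = 0\<close>.\<close>

definition blowup_coord ::
  "complex^2 \<Rightarrow> (coord \<Rightarrow> complex) \<Rightarrow> (coord \<times> complex \<times> complex) set" where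
  "blowup_coord q s = {((x, u, v), a, b). (x, u, v) \<in> hcoord \<and> (a, b) \<noteq> (0, 0) \<and>
     a * s (x, u, v) = b * fib q x}"

text \<open>First type, performed on the fibre over \<open>q\<close>: the centre is its point \<open>u = 0\<close> on the
  exceptional section. The contraction of \<open>a = 0\<close> is \<open>(x, u, v, a, b) \<mapsto> (x, b, a v)\<close>. The
  transformation is recorded as the set of pairs formed by the images of a point of the blown-up
  surface in \<open>F\<^sub>n\<close> and in \<open>F\<^sub>n\<^sub>+\<^sub>1\<close>.\<close>

definition elem_first :: "nat \<Rightarrow> complex^2 \<Rightarrow> (fpoint \<times> fpoint) set" where
  "elem_first n q = {(hpt n (x, u, v), hpt (Suc n) (x, b, a * v)) | x u v a b.
     ((x, u, v), a, b) \<in> blowup_coord q (\<lambda>(x, u, v). u)}"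

text \<open>Second type, performed on the fibre over \<open>q\<close> of \<open>F\<^sub>n\<^sub>+\<^sub>1\<close>: the centre is the intersection of this
  fibre with the section \<open>v = p(x) u\<close>, where \<open>p\<close> is a binary form of degree \<open>n + 1\<close>. That section is
  disjoint from the exceptional one, and every point of the fibre outside the exceptional section is
  obtained; two forms \<open>p\<close> giving the same centre give the same transformation up to an automorphism
  of \<open>F\<^sub>n\<close>. The contraction of \<open>a = 0\<close> is \<open>(x, u, v, a, b) \<mapsto> (x, a u, b)\<close>.\<close>

definition elem_second :: "nat \<Rightarrow> complex^2 \<Rightarrow> 2 cpoly \<Rightarrow> (fpoint \<times> fpoint) set" where
  "elem_second n q p = {(hpt (Suc n) (x, u, v), hpt n (x, a * u, b)) | x u v a b.
     ((x, u, v), a, b) \<in> blowup_coord q (\<lambda>(x, u, v). v - peval p x * u)}"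

definition second_centre :: "nat \<Rightarrow> complex^2 \<Rightarrow> 2 cpoly \<Rightarrow> fpoint" where
  "second_centre n q p = hpt (Suc n) (q, 1, peval p q)"

text \<open>The contraction in the first type is itself a blow-up read backwards, and vice versa.\<close>

lemma elem_first_converse:
  shows "(elem_first n q)\<inverse> = elem_second n q 0"
proof -
  have eval0: "peval (0 :: 2 cpoly) x = 0" for x
    by (simp add: peval_def)
  have firstI: "(y, z) \<in> (elem_first n q)\<inverse>"
    if "((x, u, v), a, b) \<in> blowup_coord q (\<lambda>(x, u, v). u)"
      "z = hpt n (x, u, v)" "y = hpt (Suc n) (x, b, a * v)" for x u v a b y z
    using that unfolding elem_first_def by blast
  have secondI: "(y, z) \<in> elem_second n q 0"
    if "((x, u, v), a, b) \<in> blowup_coord q (\<lambda>(x, u, v). v - peval 0 x * u)"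
      "y = hpt (Suc n) (x, u, v)" "z = hpt n (x, a * u, b)" for x u v a b y z
    using that unfolding elem_second_def by blast
  show ?thesis
  proof (intro set_eqI iffI)
    fix t assume "t \<in> (elem_first n q)\<inverse>"
    then obtain x u v a b where t: "t = (hpt (Suc n) (x, b, a * v), hpt n (x, u, v))"
      and "((x, u, v), a, b) \<in> blowup_coord q (\<lambda>(x, u, v). u)"
      by (auto simp: elem_first_def)
    then have xs: "x \<noteq> 0" "(u, v) \<noteq> (0, 0)" "(a, b) \<noteq> (0, 0)" "a * u = b * fib q x"
      by (auto simp: blowup_coord_def hcoord_def)
    define a' where "a' = (if b = 0 then fib q x / a else u / b)"
    have "((x, b, a * v), a', v) \<in> blowup_coord q (\<lambda>(x, u, v). v - peval 0 x * u)" "u = a' * b"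
      using xs by (auto simp: blowup_coord_def hcoord_def eval0 a'_def field_simps)
    then show "t \<in> elem_second n q 0"
      unfolding t by (intro secondI) auto
  next
    fix t assume "t \<in> elem_second n q 0"
    then obtain x u v a b where t: "t = (hpt (Suc n) (x, u, v), hpt n (x, a * u, b))"
      and "((x, u, v), a, b) \<in> blowup_coord q (\<lambda>(x, u, v). v - peval 0 x * u)"
      by (auto simp: elem_second_def)
    then have xs: "x \<noteq> 0" "(u, v) \<noteq> (0, 0)" "(a, b) \<noteq> (0, 0)" "a * v = b * fib q x"
      by (auto simp: blowup_coord_def hcoord_def eval0)
    define a' where "a' = (if b = 0 then fib q x / a else v / b)"
    have "((x, a * u, b), a', u) \<in> blowup_coord q (\<lambda>(x, u, v). u)" "v = a' * b"
      using xs by (auto simp: blowup_coord_def hcoord_def a'_def field_simps)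
    then show "t \<in> (elem_first n q)\<inverse>"
      unfolding t by (intro firstI) auto
  qed
qed


section \<open>The Cremona transformations\<close>

text \<open>The part of a correspondence that is one-to-one in both directions. For a blow-up or an
  elementary transformation it is the graph of the isomorphism between the complements of the
  points and curves that are blown up or contracted.\<close>

definition biregular :: "('a \<times> 'b) set \<Rightarrow> ('a \<times> 'b) set" where
  "biregular \<Gamma> = {(x, y) \<in> \<Gamma>. (\<forall>y'. (x, y') \<in> \<Gamma> \<longrightarrow> y' = y) \<and> (\<forall>x'. (x', y) \<in> \<Gamma> \<longrightarrow> x' = x)}"

text \<open>The blow-up \<open>F\<^sub>1\<close> of the plane at the point whose coordinates in the frame \<open>A\<close> are \<open>(0, 0, 1)\<close>:
  the blow-down map is \<open>(x, u, w) \<mapsto> (u x\<^sub>1 : u x\<^sub>2 : w)\<close>, which contracts the exceptional section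
  \<open>u = 0\<close>; away from it \<open>x\<close> is the line joining the point to the centre.\<close>

definition blowup_plane :: "complex^3^3 \<Rightarrow> (point2 \<times> fpoint) set" where
  "blowup_plane A = {(pt y, hpt 1 (x, u, w)) | y x u w.
     (x, u, w) \<in> hcoord \<and> A *v y = vector [u * x $ 1, u * x $ 2, w]}"

text \<open>The line through the centre of \<open>blowup_plane A\<close> whose proper transform on \<open>F\<^sub>1\<close> is the fibre
  over the base point \<open>q\<close>.\<close>

definition pencil_line :: "complex^3^3 \<Rightarrow> complex^2 \<Rightarrow> point2 set" where
  "pencil_line A q = {pt y | y. y \<noteq> 0 \<and> fib q (vector [(A *v y) $ 1, (A *v y) $ 2]) = 0}"

text \<open>Transformations of the first type on the fibres over the listed points, starting on \<open>F\<^sub>n\<close>.\<close>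

fun first_steps :: "nat \<Rightarrow> (complex^2) list \<Rightarrow> (fpoint \<times> fpoint) set" where
  "first_steps n [] = Id_on (hirzebruch n)"
| "first_steps n (q # qs) = biregular (elem_first n q) O first_steps (Suc n) qs"

text \<open>\<open>N\<close> transformations of the second type on the fibre over \<open>r\<close>, from \<open>F\<^sub>N\<^sub>+\<^sub>1\<close> to \<open>F\<^sub>1\<close>, where \<open>N\<close> is the
  length of the list.\<close>

fun second_steps :: "complex^2 \<Rightarrow> 2 cpoly list \<Rightarrow> (fpoint \<times> fpoint) set" where
  "second_steps r [] = Id_on (hirzebruch 1)"
| "second_steps r (p # ps) = biregular (elem_second (Suc (length ps)) r p) O second_steps r ps"

text \<open>The lines \<open>Qs\<close> through \<open>Op\<close> meet the boundary of a disk \<open>\<phi>\<close> centred at \<open>Op\<close> in points in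
  counterclockwise order. The disk is any continuously embedded closed disk in the plane (given by
  a lift to homogeneous coordinates), oriented by its parametrisation; a line may have further
  points on the boundary, as do the antipodal ones in the case of real lines and a flat disk.\<close>

definition counterclockwise :: "point2 \<Rightarrow> point2 set list \<Rightarrow> bool" where
  "counterclockwise Op Qs \<longleftrightarrow> (\<exists>(\<phi> :: complex \<Rightarrow> complex^3) (\<theta> :: nat \<Rightarrow> real).
     continuous_on (cball 0 1) \<phi> \<and> (\<forall>z\<in>cball 0 1. \<phi> z \<noteq> 0) \<and>
     inj_on (\<lambda>z. pt (\<phi> z)) (cball 0 1) \<and> pt (\<phi> 0) = Op \<and>
     (\<forall>i<length Qs. 0 \<le> \<theta> i \<and> \<theta> i < 2 * pi \<and> pt (\<phi> (cis (\<theta> i))) \<in> Qs ! i) \<and>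
     (\<forall>j<length Qs. \<forall>i<j. \<theta> i < \<theta> j))"

text \<open>\<open>T\<close> is a transformation \<open>T\<^bsub>(n\<^sub>1,\<dots>,n\<^sub>k)\<^esub>\<close> obtained by the construction for the curve \<open>C\<close>, restricted
  to the open set where all its steps are isomorphisms. The frame \<open>A\<close> has \<open>Op\<close> as the point
  \<open>(0 : 0 : 1)\<close>; \<open>B\<close> is the coordinate system of the final plane. The \<open>j\<close>-th transformation on \<open>P\<close>
  starts from \<open>F\<^bsub>N+1-j\<^esub>\<close> (counting from 0), and its centre is given by the form \<open>ps ! j\<close>.

  The last condition makes explicit that the point blown up by the first transformation on \<open>P\<close> is
  not on the proper transform of \<open>C\<close> (otherwise the degree drops). For the later ones this is
  automatic: the proper transform of \<open>C\<close> then meets the new fibre only on the exceptional section.\<close>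

definition cremona_T :: "point2 set \<Rightarrow> nat list \<Rightarrow> (point2 \<times> point2) set \<Rightarrow> bool" where
  "cremona_T C ns T \<longleftrightarrow> (\<exists>Op Qs P A B qs r ps.
     invertible A \<and> (\<exists>y. Op = pt y \<and> A *v y = axis 3 1) \<and> Op \<notin> C \<and>
     length qs = length ns \<and> 0 \<notin> set qs \<and> r \<noteq> 0 \<and>
     Qs = map (pencil_line A) qs \<and> P = pencil_line A r \<and> distinct (P # Qs) \<and>
     (\<forall>L\<in>set (P # Qs). meets_transversally L C) \<and> counterclockwise Op Qs \<and>
     invertible B \<and> length ps = sum_list ns \<and>
     (\<forall>j<length ps. homogeneous (length ps + 1 - j) (ps ! j)) \<and>
     (let \<Phi> = biregular (blowup_plane A) O first_steps 1 (concat (map2 replicate ns qs)) in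
        T = \<Phi> O second_steps r ps O (biregular (blowup_plane B))\<inverse> \<and>
        (ps \<noteq> [] \<longrightarrow> second_centre (length ps) r (hd ps) \<notin> \<Phi> `` C)))"

definition proper_transform :: "(point2 \<times> point2) set \<Rightarrow> point2 set \<Rightarrow> point2 set" where
  "proper_transform T C = zariski_closure (T `` C)"

end

theory Submission
  imports Defs
    "HOL-Computational_Algebra.Field_as_Ring"
    "HOL-Computational_Algebra.Polynomial_Factorial"
    "HOL-Computational_Algebra.Fundamental_Theorem_Algebra"
begin

text \<open>In coordinates \<open>(x, w)\<close> in which the centre is \<open>(0 : 0 : 1)\<close>, an elementary transformation of
  the first type multiplies the fibre coordinate by the equation of its fibre, and one of the second
  type divides it after subtracting a form. The composite is \<open>(x, w) \<mapsto> (l x, h w - p)\<close>, where \<open>h\<close> is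
  the product of the equations of the lines \<open>Q\<^sub>i\<close> with multiplicities \<open>n\<^sub>i\<close>, \<open>l\<close> the \<open>N\<close>-th power of the
  equation of \<open>P\<close>, \<open>N = \<Sum> n\<^sub>i\<close>, and \<open>p\<close> a form of degree \<open>N + 1\<close>. Hence the equation \<open>f = 0\<close> of \<open>C\<close>
  becomes \<open>g (x, w) = f (h x, l w + p) = 0\<close>, of degree \<open>d (N + 1)\<close>. It remains to see that \<open>g\<close> is a
  reduced equation of the closure of the image. Since \<open>C\<close> avoids the centre, \<open>g\<close> has degree \<open>d\<close> in \<open>w\<close>
  with leading coefficient a multiple of \<open>l\<^sup>d\<close>, and on \<open>l = 0\<close> it is a nonzero constant in \<open>w\<close> because
  the first centre on \<open>P\<close> is not on the curve; so no fibre lies on \<open>g = 0\<close>, and continuity of roots gives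
  the closure. A square factor of \<open>g\<close> cannot involve \<open>w\<close>, since \<open>f\<close> is reduced and hence has simple
  roots on the general fibre, and then it is constant, since it vanishes on no fibre.\<close>

section \<open>Evaluation of formal polynomials: ring laws and injectivity\<close>

abbreviation cmonom :: "('v::finite \<Rightarrow>\<^sub>0 nat) \<Rightarrow> complex^'v \<Rightarrow> complex" where
  "cmonom m x \<equiv> (\<Prod>i\<in>UNIV. x $ i ^ Poly_Mapping.lookup m i)"

lemma peval_superset:
  assumes "finite S" "Poly_Mapping.keys F \<subseteq> S"
  shows "peval F x = (\<Sum>m\<in>S. Poly_Mapping.lookup F m * cmonom m x)"
  unfolding peval_def using assms
  by (intro sum.mono_neutral_left) (auto simp: in_keys_iff)

lemma peval_0 [simp]: "peval 0 x = 0"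
  by (simp add: peval_def)

lemma peval_single: "peval (Poly_Mapping.single m c) x = c * cmonom m x"
  by (subst peval_superset[of "{m}"]) auto

lemma peval_1 [simp]: "peval 1 x = 1"
  using peval_single[of 0 1 x] by simp

lemma peval_add: "peval (F + G) x = peval F x + peval G x"
proof -
  let ?S = "Poly_Mapping.keys F \<union> Poly_Mapping.keys G"
  have "Poly_Mapping.keys (F + G) \<subseteq> ?S"
    by (rule keys_add)
  then show ?thesis
    by (simp add: peval_superset[of ?S] lookup_add distrib_right sum.distrib)
qed

lemma peval_uminus: "peval (- F) x = - peval F x"
  using peval_add[of F "- F" x] by (simp add: add_eq_0_iff)

lemma peval_diff: "peval (F - G) x = peval F x - peval G x"
  using peval_add[of F "- G" x] by (simp add: peval_uminus)

lemma cmonom_add: "cmonom (k + l) x = cmonom k x * cmonom l x"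
  by (simp add: lookup_add power_add prod.distrib)

text \<open>Adding a single term instead of updating a key is the form of induction to which
  additivity and distributivity apply.\<close>

lemma poly_mapping_single_induct [case_names zero add_single]:
  assumes "P 0" "\<And>f a b. P f \<Longrightarrow> P (f + Poly_Mapping.single a b)"
  shows "P f"
proof (induction f rule: update_induct)
  case (update f a b)
  have "Poly_Mapping.update a b f = f + Poly_Mapping.single a b"
    using update(1)
    by (intro poly_mapping_eqI)
      (auto simp: lookup_update lookup_add lookup_single in_keys_iff)
  then show ?case using assms(2)[OF update(3)] by simp
qed (rule assms)

lemma peval_mult: "peval (F * G) x = peval F x * peval G x"
proof (induction F rule: poly_mapping_single_induct)
  case (add_single F a b)
  have "peval (Poly_Mapping.single a b * G) x = peval (Poly_Mapping.single a b) x * peval G x"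
  proof (induction G rule: poly_mapping_single_induct)
    case (add_single G c d)
    then show ?case
      by (simp add: distrib_left peval_add mult_single peval_single cmonom_add)
  qed simp
  with add_single show ?case
    by (simp add: distrib_right peval_add)
qed simp

lemma prod_3: "prod f (UNIV::3 set) = f 1 * f 2 * f 3"
  unfolding UNIV_3 by (simp add: ac_simps)

text \<open>Uniqueness of digits to the base \<open>B\<close>: reduction modulo \<open>B\<close>
  reads off the lowest digit, and the last one may be arbitrarily large.\<close>

lemma kronecker_inj:
  fixes B :: nat
  assumes "a1 < B" "a2 < B" "b1 < B" "b2 < B"
    and "a1 + B * (a2 + B * a3) = b1 + B * (b2 + B * b3)"
  shows "a1 = b1 \<and> a2 = b2 \<and> a3 = b3"
proof -
  have "(a1 + B * (a2 + B * a3)) mod B = a1" "(b1 + B * (b2 + B * b3)) mod B = b1"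
    using assms(1,3) by simp_all
  with assms(5) have 1: "a1 = b1" by metis
  with assms have "a2 + B * a3 = b2 + B * b3" by simp
  moreover have "(a2 + B * a3) mod B = a2" "(b2 + B * b3) mod B = b2"
    using assms(2,4) by simp_all
  ultimately have "a2 = b2" by metis
  with 1 assms show ?thesis by simp
qed

text \<open>The Kronecker substitution \<open>(t, t\<^sup>B, t\<^bsup>B\<^sup>2\<^esup>)\<close> with \<open>B\<close> larger than all exponents keeps
  distinct monomials distinct.\<close>

lemma peval_eq_0_imp_eq_0:
  fixes F :: "3 cpoly"
  assumes "\<And>x. peval F x = 0"
  shows "F = 0"
proof -
  let ?K = "Poly_Mapping.keys F"
  define B where "B = Suc (\<Sum>m\<in>?K. \<Sum>i\<in>UNIV. Poly_Mapping.lookup m i)"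
  have B: "Poly_Mapping.lookup m i < B" if "m \<in> ?K" for m i
  proof -
    have "Poly_Mapping.lookup m i \<le> (\<Sum>i\<in>UNIV. Poly_Mapping.lookup m i)"
      by (rule member_le_sum) auto
    also have "\<dots> \<le> (\<Sum>m\<in>?K. \<Sum>i\<in>UNIV. Poly_Mapping.lookup m i)"
      using that by (rule member_le_sum) auto
    finally show ?thesis by (simp add: B_def)
  qed
  define e where "e m = Poly_Mapping.lookup m (1::3) + B * (Poly_Mapping.lookup m 2 + B * Poly_Mapping.lookup m 3)" for m
  have inj: "inj_on e ?K"
  proof (rule inj_onI)
    fix m k assume mk: "m \<in> ?K" "k \<in> ?K" "e m = e k"
    have "\<forall>i. Poly_Mapping.lookup m i = Poly_Mapping.lookup k i"
      unfolding forall_3 using mk B by (intro kronecker_inj[of _ B]) (auto simp: e_def)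
    then show "m = k" by (intro poly_mapping_eqI) auto
  qed
  \<comment> \<open>The substitution applied to \<open>F\<close>, as a univariate polynomial; by
    \<open>inj\<close> no two of its terms are merged.\<close>
  define p where "p = (\<Sum>m\<in>?K. monom (Poly_Mapping.lookup F m) (e m))"
  have "poly p t = peval F (vector [t, t ^ B, t ^ (B * B)])" for t
  proof -
    have "t ^ e m = t ^ Poly_Mapping.lookup m 1 * (t ^ B) ^ Poly_Mapping.lookup m 2 *
        (t ^ (B * B)) ^ Poly_Mapping.lookup m 3" for m
      unfolding e_def by (simp add: distrib_left power_add power_mult)
    then show ?thesis
      unfolding p_def peval_def poly_sum poly_monom prod_3 vector_3 by simp
  qed
  then have "p = 0"
    using assms by (intro poly_ext) auto
  have "Poly_Mapping.lookup F m = 0" if "m \<in> ?K" for m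
  proof -
    have "0 = coeff p (e m)" using \<open>p = 0\<close> by simp
    also have "\<dots> = (\<Sum>k\<in>?K. if k = m then Poly_Mapping.lookup F k else 0)"
      unfolding p_def coeff_sum
      by (intro sum.cong) (use inj that in \<open>auto simp: inj_on_eq_iff\<close>)
    also have "\<dots> = Poly_Mapping.lookup F m" using that by simp
    finally show ?thesis by simp
  qed
  then show ?thesis
    by (intro poly_mapping_eqI) (auto simp: in_keys_iff)
qed

text \<open>Brings identities between polynomial functions back to formal polynomials, where
  \<open>squarefree\<close> and divisibility are defined.\<close>

lemma peval_inject:
  fixes F G :: "3 cpoly"
  assumes "\<And>x. peval F x = peval G x"
  shows "F = G"
  using peval_eq_0_imp_eq_0[of "F - G"] assms by (simp add: peval_diff)

section \<open>Polynomial functions and forms\<close>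

text \<open>Functions rather than formal polynomials, so that substitution is plain composition and
  limits can be taken directly.\<close>

definition polyfun :: "(complex^'v::finite \<Rightarrow> complex) \<Rightarrow> bool" where
  "polyfun f \<longleftrightarrow> (\<exists>F. peval F = f)"

definition form :: "nat \<Rightarrow> (complex^'v::finite \<Rightarrow> complex) \<Rightarrow> bool" where
  "form d f \<longleftrightarrow> (\<exists>F. homogeneous d F \<and> peval F = f)"

lemma form_imp_polyfun: "form d f \<Longrightarrow> polyfun f"
  by (auto simp: form_def polyfun_def)

lemma polyfun_add: "polyfun f \<Longrightarrow> polyfun g \<Longrightarrow> polyfun (\<lambda>x. f x + g x)"
  unfolding polyfun_def by (metis peval_add ext)

lemma polyfun_diff: "polyfun f \<Longrightarrow> polyfun g \<Longrightarrow> polyfun (\<lambda>x. f x - g x)"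
  unfolding polyfun_def by (metis peval_diff ext)

lemma polyfun_mult: "polyfun f \<Longrightarrow> polyfun g \<Longrightarrow> polyfun (\<lambda>x. f x * g x)"
  unfolding polyfun_def by (metis peval_mult ext)

lemma homogeneous_single: "(\<Sum>i\<in>UNIV. Poly_Mapping.lookup m i) = d \<Longrightarrow> homogeneous d (Poly_Mapping.single m c)"
  by (auto simp: homogeneous_def)

lemma form_const: "form 0 (\<lambda>x. c)"
  unfolding form_def
  by (intro exI[of _ "Poly_Mapping.single 0 c"]) (auto simp: peval_single homogeneous_single)

lemma polyfun_const: "polyfun (\<lambda>x. c)"
  by (rule form_imp_polyfun[OF form_const])

lemma form_0: "form d (\<lambda>x. 0)"
  unfolding form_def by (intro exI[of _ 0]) (auto simp: homogeneous_def)

lemma form_coord: "form 1 (\<lambda>x. x $ i)"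
proof -
  have "peval (Poly_Mapping.single (Poly_Mapping.single i 1) 1) x = x $ i" for x
  proof -
    have "x $ j ^ Poly_Mapping.lookup (Poly_Mapping.single i 1) j = (if j = i then x $ i else 1)" for j
      by (auto simp: lookup_single when_def)
    then show ?thesis unfolding peval_single by simp
  qed
  moreover have "homogeneous 1 (Poly_Mapping.single (Poly_Mapping.single i 1) 1)"
    by (rule homogeneous_single) (simp add: lookup_single when_def)
  ultimately show ?thesis unfolding form_def by blast
qed

lemma polyfun_coord: "polyfun (\<lambda>x. x $ i)"
  by (rule form_imp_polyfun[OF form_coord])

lemma form_add: "form d f \<Longrightarrow> form d g \<Longrightarrow> form d (\<lambda>x. f x + g x)"
proof -
  assume "form d f" "form d g"
  then obtain F G where "homogeneous d F" "peval F = f" "homogeneous d G" "peval G = g"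
    by (auto simp: form_def)
  then show ?thesis
    unfolding form_def using keys_add[of F G]
    by (intro exI[of _ "F + G"]) (auto simp: homogeneous_def peval_add)
qed

lemma form_mult: "form d f \<Longrightarrow> form e g \<Longrightarrow> form (d + e) (\<lambda>x. f x * g x)"
proof -
  assume "form d f" "form e g"
  then obtain F G where FG: "homogeneous d F" "peval F = f" "homogeneous e G" "peval G = g"
    by (auto simp: form_def)
  have "homogeneous (d + e) (F * G)"
    unfolding homogeneous_def
  proof
    fix m assume "m \<in> Poly_Mapping.keys (F * G)"
    then obtain a b where "m = a + b" "a \<in> Poly_Mapping.keys F" "b \<in> Poly_Mapping.keys G"
      using keys_mult[of F G] by auto
    then show "(\<Sum>i\<in>UNIV. Poly_Mapping.lookup m i) = d + e"
      using FG by (auto simp: homogeneous_def lookup_add sum.distrib)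
  qed
  then show ?thesis
    unfolding form_def using FG
    by (intro exI[of _ "F * G"]) (auto simp: peval_mult)
qed

lemma form_sum:
  assumes "\<And>i. i \<in> I \<Longrightarrow> form d (f i)"
  shows "form d (\<lambda>x. \<Sum>i\<in>I. f i x)"
  using assms by (induction I rule: infinite_finite_induct) (auto intro: form_0 form_add)

lemma form_power: "form d f \<Longrightarrow> form (n * d) (\<lambda>x. f x ^ n)"
  by (induction n) (auto intro: form_const form_mult)

lemma form_prod:
  assumes "\<And>i. i \<in> I \<Longrightarrow> form (e i) (f i)"
  shows "form (\<Sum>i\<in>I. e i) (\<lambda>x. \<Prod>i\<in>I. f i x)"
  using assms by (induction I rule: infinite_finite_induct) (auto intro: form_const form_mult)

lemma form_cmult: "form d f \<Longrightarrow> form d (\<lambda>x. c * f x)"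
  using form_mult[OF form_const, of d f c] by simp

lemma form_diff: "form d f \<Longrightarrow> form d g \<Longrightarrow> form d (\<lambda>x. f x - g x)"
  using form_add[OF _ form_cmult, of d f g "-1"] by simp

text \<open>Each monomial of \<open>f\<close> turns into a product of \<open>d\<close> factors, each
  of degree \<open>e\<close>.\<close>

lemma form_compose:
  fixes f :: "complex^'v::finite \<Rightarrow> complex" and g :: "'v \<Rightarrow> complex^'w::finite \<Rightarrow> complex"
  assumes "form d f" "\<And>i. form e (g i)"
  shows "form (d * e) (\<lambda>x. f (\<chi> i. g i x))"
proof -
  obtain F where F: "homogeneous d F" "peval F = f"
    using assms by (auto simp: form_def)
  have "form (d * e) (\<lambda>x. \<Prod>i\<in>UNIV. g i x ^ Poly_Mapping.lookup m i)"
    if "m \<in> Poly_Mapping.keys F" for m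
  proof -
    have "d = (\<Sum>i\<in>UNIV. Poly_Mapping.lookup m i)"
      using that F(1) by (auto simp: homogeneous_def)
    then have "d * e = (\<Sum>i\<in>UNIV. Poly_Mapping.lookup m i * e)"
      by (simp add: sum_distrib_right)
    then show ?thesis
      using form_prod[OF form_power[OF assms(2)]] by simp
  qed
  then show ?thesis
    by (simp add: F(2)[symmetric] peval_def form_sum form_cmult)
qed

lemma polyfun_sum:
  assumes "\<And>i. i \<in> I \<Longrightarrow> polyfun (f i)"
  shows "polyfun (\<lambda>x. \<Sum>i\<in>I. f i x)"
  using assms
  by (induction I rule: infinite_finite_induct) (auto intro: polyfun_const polyfun_add)

lemma polyfun_power: "polyfun f \<Longrightarrow> polyfun (\<lambda>x. f x ^ n)"
  by (induction n) (auto intro: polyfun_const polyfun_mult)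

lemma polyfun_prod:
  assumes "\<And>i. i \<in> I \<Longrightarrow> polyfun (f i)"
  shows "polyfun (\<lambda>x. \<Prod>i\<in>I. f i x)"
  using assms
  by (induction I rule: infinite_finite_induct) (auto intro: polyfun_const polyfun_mult)

lemma polyfun_compose:
  assumes "polyfun f" "\<And>i. polyfun (g i)"
  shows "polyfun (\<lambda>x. f (\<chi> i. g i x))"
proof -
  obtain F where F: "peval F = f"
    using assms by (auto simp: polyfun_def)
  have "polyfun (\<lambda>x. peval F (\<chi> i. g i x))"
    unfolding peval_def
    by (auto intro!: polyfun_sum polyfun_mult polyfun_const polyfun_prod polyfun_power assms)
  then show ?thesis by (simp add: F)
qed

lemma form_matrix_vector: "form 1 (\<lambda>x. (A *v x) $ i)"
  unfolding matrix_vector_mult_def by (simp add: form_sum form_cmult form_coord[unfolded One_nat_def])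

lemma polyfun_linear:
  assumes "polyfun f"
  shows "polyfun (\<lambda>x. f (A *v x))"
  using polyfun_compose[OF assms, of "\<lambda>i x. (A *v x) $ i", OF form_imp_polyfun[OF form_matrix_vector]]
  by simp

lemma form_linear:
  assumes "form d f"
  shows "form d (\<lambda>x. f (A *v x))"
  using form_compose[OF assms, of 1 "\<lambda>i x. (A *v x) $ i", OF form_matrix_vector]
  by simp

lemma form_scale:
  assumes "form d f"
  shows "f (c *s x) = c ^ d * f x"
proof -
  obtain F where F: "homogeneous d F" "peval F = f"
    using assms by (auto simp: form_def)
  have "peval F (c *s x) = (\<Sum>m\<in>Poly_Mapping.keys F. c ^ d * (Poly_Mapping.lookup F m * cmonom m x))"
    unfolding peval_def
  proof (intro sum.cong refl)
    fix m assume "m \<in> Poly_Mapping.keys F"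
    then have "c ^ d = (\<Prod>i\<in>UNIV. c ^ Poly_Mapping.lookup m i)"
      using F(1) by (auto simp: homogeneous_def simp flip: power_sum)
    then show "Poly_Mapping.lookup F m * (\<Prod>i\<in>UNIV. (c *s x) $ i ^ Poly_Mapping.lookup m i) =
        c ^ d * (Poly_Mapping.lookup F m * cmonom m x)"
      by (simp add: power_mult_distrib prod.distrib)
  qed
  then show ?thesis
    by (simp add: F(2)[symmetric] peval_def sum_distrib_left)
qed

lemma polyfun_tendsto:
  assumes "polyfun f" "(g \<longlongrightarrow> l) S"
  shows "((\<lambda>t. f (g t)) \<longlongrightarrow> f l) S"
proof -
  obtain F where F: "peval F = f"
    using assms by (auto simp: polyfun_def)
  show ?thesis
    unfolding F[symmetric] peval_def by (intro tendsto_intros assms)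
qed

lemma polyfun_line:
  assumes "polyfun f"
  obtains p where "\<And>t. poly p t = f (a + t *s b)"
proof -
  obtain F where F: "peval F = f"
    using assms by (auto simp: polyfun_def)
  let ?p = "\<Sum>m\<in>Poly_Mapping.keys F. smult (Poly_Mapping.lookup F m)
    (\<Prod>i\<in>UNIV. [:a $ i, b $ i:] ^ Poly_Mapping.lookup m i)"
  have "poly ?p t = f (a + t *s b)" for t
    unfolding F[symmetric] peval_def by (simp add: poly_sum poly_prod)
  then show ?thesis using that by blast
qed

text \<open>Polynomial functions have no zero divisors: on the line through \<open>a\<close> and
  \<open>x\<close> both factors become univariate polynomials with product zero, and the first does
  not vanish at \<open>a\<close>.\<close>

lemma polyfun_mult_eq_0:
  fixes f g :: "complex^'v::finite \<Rightarrow> complex"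
  assumes "polyfun f" "polyfun g" "\<And>x. f x * g x = 0" "f a \<noteq> 0"
  shows "g x = 0"
proof -
  obtain p where p: "\<And>t. poly p t = f (a + t *s (x - a))"
    using polyfun_line[OF assms(1), of a "x - a"] by blast
  obtain q where q: "\<And>t. poly q t = g (a + t *s (x - a))"
    using polyfun_line[OF assms(2), of a "x - a"] by blast
  have "p * q = 0"
    by (rule poly_ext) (simp add: p q assms(3))
  moreover have "poly p 0 \<noteq> 0" using assms(4) by (simp add: p)
  ultimately have "q = 0" by auto
  then show ?thesis using q[of 1] by simp
qed

section \<open>Reduced equations and their fibres\<close>

text \<open>The coefficients need not form a field, so prime factors may be constants; additivity of
  the degree over products still leaves one of positive degree.\<close>

lemma prime_factor_pos_degree:
  fixes h :: "'a::{factorial_ring_gcd,semiring_gcd_mult_normalize} poly"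
  assumes "h \<noteq> 0" "degree h > 0"
  shows "\<exists>q. prime_elem q \<and> degree q > 0 \<and> q dvd h"
  using assms
proof (induction h rule: prime_divisors_induct)
  case (unit x)
  then show ?case by (auto simp: is_unit_poly_iff)
next
  case (factor p x)
  show ?case
  proof (cases "degree p > 0")
    case True
    then show ?thesis using factor by (intro exI[of _ p]) auto
  next
    case False
    with factor have "x \<noteq> 0" "degree x > 0" by (auto simp: degree_mult_eq)
    with factor show ?thesis by (meson dvd_mult)
  qed
qed auto

text \<open>Take \<open>h\<close> of least degree in the ideal \<open>(p, q)\<close>: by pseudo-division it divides both \<open>p\<close> and \<open>q\<close>
  up to constants, hence so do its prime factors of positive degree.\<close>

lemma bezout_or_common_factor:
  fixes p q :: "'a::{factorial_ring_gcd,semiring_gcd_mult_normalize} poly"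
  assumes "p \<noteq> 0"
  shows "(\<exists>a b c. c \<noteq> 0 \<and> a * p + b * q = [:c:]) \<or>
    (\<exists>r. prime_elem r \<and> degree r > 0 \<and> r dvd p \<and> r dvd q)"
proof -
  define I where "I h \<longleftrightarrow> h \<noteq> 0 \<and> (\<exists>a b. h = a * p + b * q)" for h
  have "p = 1 * p + 0 * q" by simp
  then have "I p" using assms unfolding I_def by blast
  then obtain h where h: "I h" and min: "\<And>h'. I h' \<Longrightarrow> degree h \<le> degree h'"
    using ex_has_least_nat[of I p degree] by blast
  obtain a b where ab: "h = a * p + b * q" and "h \<noteq> 0"
    using h by (auto simp: I_def)
  have dvd: "\<exists>c. c \<noteq> 0 \<and> h dvd smult c f" if "f = a' * p + b' * q" for f a' b'
  proof -
    obtain c k where ck: "c \<noteq> 0" "smult c f = h * k + pseudo_mod f h"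
      using pseudo_mod(1)[OF \<open>h \<noteq> 0\<close>] by blast
    \<comment> \<open>The pseudo-remainder lies in the ideal again, so were it nonzero, its degree
      would be below the least one.\<close>
    have "pseudo_mod f h = smult c f - h * k" using ck by simp
    also have "\<dots> = (smult c a' - k * a) * p + (smult c b' - k * b) * q"
      unfolding that ab by (simp add: algebra_simps smult_add_right)
    finally have "pseudo_mod f h \<noteq> 0 \<Longrightarrow> I (pseudo_mod f h)"
      unfolding I_def by blast
    with min pseudo_mod(2)[OF \<open>h \<noteq> 0\<close>] have "pseudo_mod f h = 0"
      by (metis not_less)
    with ck show ?thesis by auto
  qed
  show ?thesis
  proof (cases "degree h = 0")
    case True
    then obtain c where "h = [:c:]" by (rule degree_eq_zeroE)
    with ab \<open>h \<noteq> 0\<close> have "c \<noteq> 0 \<and> a * p + b * q = [:c:]" by auto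
    then show ?thesis by blast
  next
    case False
    then obtain r where r: "prime_elem r" "degree r > 0" "r dvd h"
      using prime_factor_pos_degree[OF \<open>h \<noteq> 0\<close>] by auto
    have "r dvd f" if "f = a' * p + b' * q" for f a' b'
    proof -
      obtain c where c: "c \<noteq> 0" "h dvd smult c f" using dvd[OF \<open>f = _\<close>] by blast
      then have "r dvd [:c:] * f" using r(3) by (simp add: dvd_trans)
      moreover have "\<not> r dvd [:c:]"
      proof
        assume "r dvd [:c:]"
        then have "degree r \<le> degree [:c:]"
          using c(1) by (intro dvd_imp_degree_le) auto
        then show False using r(2) by simp
      qed
      ultimately show ?thesis using r(1) prime_elem_dvd_mult_iff by blast
    qed
    from this[of p 1 0] this[of q 0 1] have "r dvd p" "r dvd q" by simp_all
    with r show ?thesis by blast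
  qed
qed

text \<open>For \<open>g = r * k\<close> the product rule shows that \<open>r\<close> divides
  \<open>k * pderiv r\<close>. In characteristic zero \<open>pderiv r\<close> is nonzero and of
  smaller degree than \<open>r\<close>, so the prime \<open>r\<close> must divide
  \<open>k\<close>.\<close>

lemma prime_dvd_pderiv_imp_square_dvd:
  fixes r g :: "'a::{idom,semiring_char_0,algebraic_semidom} poly"
  assumes "prime_elem r" "degree r > 0" "r dvd g" "r dvd pderiv g"
  shows "r ^ 2 dvd g"
proof -
  obtain k where k: "g = r * k" using assms(3) by blast
  then have "pderiv g = r * pderiv k + k * pderiv r"
    by (simp add: pderiv_mult)
  then have "r dvd k * pderiv r"
    using assms(4) by (metis dvd_add_right_iff dvd_triv_left)
  moreover have "\<not> r dvd pderiv r"
  proof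
    assume "r dvd pderiv r"
    moreover have "pderiv r \<noteq> 0" using assms(2) by (simp add: pderiv_eq_0_iff)
    ultimately have "degree r \<le> degree (pderiv r)" by (rule dvd_imp_degree_le)
    with assms(2) show False by (simp add: degree_pderiv)
  qed
  ultimately have "r dvd k" using assms(1) prime_elem_dvd_mult_iff by blast
  then show ?thesis unfolding k by (simp add: power2_eq_square mult_dvd_mono)
qed

section \<open>Ternary polynomials as iterated univariate ones\<close>

definition ev2 :: "complex poly poly \<Rightarrow> complex \<Rightarrow> complex \<Rightarrow> complex" where
  "ev2 p a b = poly (poly p [:b:]) a"

text \<open>The outermost variable is \<open>w\<close>, so that divisibility is studied in one
  variable over the factorial ring of polynomials in \<open>a\<close> and \<open>b\<close>.\<close>

definition ev3 :: "complex poly poly poly \<Rightarrow> complex \<Rightarrow> complex \<Rightarrow> complex \<Rightarrow> complex" where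
  "ev3 p a b w = ev2 (poly p [:[:w:]:]) a b"

text \<open>The restriction to the fibre over \<open>(a, b)\<close>, kept as a polynomial in
  \<open>w\<close> so that its degree, derivative and roots are available.\<close>

definition slice :: "complex poly poly poly \<Rightarrow> complex \<Rightarrow> complex \<Rightarrow> complex poly" where
  "slice p a b = map_poly (\<lambda>c. ev2 c a b) p"

lemma ev2_simps:
  "ev2 0 a b = 0" "ev2 1 a b = 1" "ev2 [:[:z:]:] a b = z"
  "ev2 (p + q) a b = ev2 p a b + ev2 q a b"
  "ev2 (p * q) a b = ev2 p a b * ev2 q a b"
  "ev2 (sum h S) a b = (\<Sum>i\<in>S. ev2 (h i) a b)"
  "ev2 (monom (monom z i) j) a b = z * a ^ i * b ^ j"
  "ev2 (of_nat n) a b = of_nat n"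
  "ev2 (smult [:z:] p) a b = z * ev2 p a b"
  by (simp_all add: ev2_def poly_sum poly_monom poly_const_pow)

lemma ev3_simps:
  "ev3 (p + q) a b w = ev3 p a b w + ev3 q a b w"
  "ev3 (p * q) a b w = ev3 p a b w * ev3 q a b w"
  "ev3 (p ^ n) a b w = ev3 p a b w ^ n"
  "ev3 (sum h S) a b w = (\<Sum>i\<in>S. ev3 (h i) a b w)"
  "ev3 [:c:] a b w = ev2 c a b"
  by (induction n) (simp_all add: ev3_def ev2_simps poly_sum poly_power)

lemma ev3_monom: "ev3 (monom c k) a b w = ev2 c a b * w ^ k"
proof -
  have "[:[:w:]:] ^ k = [:[:w ^ k:]:]" by (simp add: poly_const_pow)
  then show ?thesis by (simp add: ev3_def poly_monom ev2_simps)
qed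

lemma poly_slice: "poly (slice p a b) w = ev3 p a b w"
proof (induction p)
  case (pCons c p)
  then show ?case
    by (simp add: slice_def map_poly_pCons ev2_simps ev3_def)
qed (simp add: slice_def ev3_def ev2_simps)

lemma pderiv_slice: "pderiv (slice p a b) = slice (pderiv p) a b"
  by (rule poly_eqI)
    (simp add: slice_def coeff_pderiv coeff_map_poly ev2_simps flip: of_nat_Suc)

text \<open>There are infinitely many constants \<open>[:b:]\<close>, so one of them avoids the
  finitely many roots of \<open>c\<close>; a nonroot of the remaining univariate polynomial gives
  \<open>a\<close>.\<close>

lemma ev2_nonzero:
  assumes "c \<noteq> 0"
  obtains a b where "ev2 c a b \<noteq> 0"
proof -
  have "inj (\<lambda>b::complex. [:b:])" by (rule injI) simp
  then have "infinite (range (\<lambda>b::complex. [:b:]))"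
    using finite_imageD infinite_UNIV_char_0 by blast
  then obtain b where "poly c [:b:] \<noteq> 0"
    using poly_roots_finite[OF assms] by (meson finite_subset image_subsetI mem_Collect_eq)
  then obtain a where "poly (poly c [:b:]) a \<noteq> 0"
    using poly_all_0_iff_0 by blast
  then show ?thesis using that by (simp add: ev2_def)
qed

lemma polyfun_poly: "polyfun f \<Longrightarrow> polyfun (\<lambda>z. poly p (f z))"
  by (induction p) (auto intro: polyfun_const polyfun_add polyfun_mult)

lemma polyfun_ev2: "polyfun f \<Longrightarrow> polyfun g \<Longrightarrow> polyfun (\<lambda>z. ev2 p (f z) (g z))"
  by (induction p)
    (simp_all add: ev2_def polyfun_const polyfun_add polyfun_mult polyfun_poly)

lemma polyfun_ev3:
  "polyfun f \<Longrightarrow> polyfun g \<Longrightarrow> polyfun h \<Longrightarrow> polyfun (\<lambda>z. ev3 p (f z) (g z) (h z))"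
  by (induction p)
    (simp_all add: ev3_def ev2_simps polyfun_const polyfun_add polyfun_mult polyfun_ev2)

text \<open>A monomial of degree \<open>d\<close> with exponent \<open>d\<close> in \<open>w\<close>
  contains no other variable; hence the coefficient of \<open>w ^ d\<close> is a constant, the value
  of \<open>f\<close> at \<open>(0, 0, 1)\<close>.\<close>

lemma form_ev3:
  fixes f :: "complex^3 \<Rightarrow> complex"
  assumes "form d f"
  obtains g where "\<And>a b w. ev3 g a b w = f (vector [a, b, w])" "degree g \<le> d"
    "\<And>a b. ev2 (coeff g d) a b = f (vector [0, 0, 1])"
proof -
  obtain F where F: "homogeneous d F" "peval F = f"
    using assms by (auto simp: form_def)
  let ?l = Poly_Mapping.lookup
  let ?t = "\<lambda>m. monom (monom (?l F m) (?l m 1)) (?l m 2)"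
  define g where "g = (\<Sum>m\<in>Poly_Mapping.keys F. monom (?t m) (?l m 3))"
  have deg: "?l m 1 + ?l m 2 + ?l m 3 = d" if "m \<in> Poly_Mapping.keys F" for m
    using F(1) that by (simp add: homogeneous_def sum_3)
  have 1: "ev3 g a b w = f (vector [a, b, w])" for a b w
    unfolding g_def ev3_simps ev3_monom ev2_simps F(2)[symmetric] peval_def prod_3 vector_3
    by (simp add: algebra_simps)
  have 2: "degree g \<le> d"
    unfolding g_def using deg
    by (intro degree_sum_le) (auto intro!: order.trans[OF degree_monom_le], metis le_add2)
  have 3: "ev2 (coeff g d) a b = f (vector [0, 0, 1])" for a b
    unfolding g_def coeff_sum coeff_monom ev2_simps F(2)[symmetric] peval_def prod_3 vector_3
  proof (intro sum.cong refl)
    fix m assume m: "m \<in> Poly_Mapping.keys F"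
    show "ev2 (if ?l m 3 = d then ?t m else 0) a b =
      ?l F m * (0 ^ ?l m 1 * 0 ^ ?l m 2 * 1 ^ ?l m 3)"
      using deg[OF m] by (auto simp: ev2_simps power_0_left)
  qed
  show ?thesis using that 1 2 3 by blast
qed

lemma form_slice:
  fixes f :: "complex^3 \<Rightarrow> complex"
  assumes "form d f"
  obtains p where "\<And>w. poly p w = f (vector [a, b, w])" "degree p \<le> d"
    "coeff p d = f (vector [0, 0, 1])"
proof -
  obtain g where g: "\<And>a b w. ev3 g a b w = f (vector [a, b, w])" "degree g \<le> d"
    "\<And>a b. ev2 (coeff g d) a b = f (vector [0, 0, 1])"
    using form_ev3[OF assms] by blast
  show ?thesis
  proof (rule that[of "slice g a b"])
    show "poly (slice g a b) w = f (vector [a, b, w])" for w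
      by (simp add: poly_slice g)
    show "degree (slice g a b) \<le> d"
      unfolding slice_def using g(2) map_poly_degree_leq order.trans by blast
    show "coeff (slice g a b) d = f (vector [0, 0, 1])"
      by (simp add: slice_def coeff_map_poly ev2_simps g(3))
  qed
qed

text \<open>The unit condition on \<open>X\<close> is phrased as having no zeros, which for complex
  polynomials amounts to being a nonzero constant.\<close>

definition reduced :: "(complex^'v::finite \<Rightarrow> complex) \<Rightarrow> bool" where
  "reduced f \<longleftrightarrow> (\<forall>X K. polyfun X \<longrightarrow> polyfun K \<longrightarrow> (\<forall>z. f z = X z ^ 2 * K z) \<longrightarrow> (\<forall>z. X z \<noteq> 0))"

text \<open>Over the polynomials in the first two variables, \<open>g\<close> and its derivative in
  \<open>w\<close> either combine to a nonzero \<open>c\<close>, off whose zeros all roots are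
  simple, or share a prime factor \<open>r\<close>, whose square then divides
  \<open>g\<close>.\<close>

lemma reduced_form_generic_slice:
  fixes f :: "complex^3 \<Rightarrow> complex"
  assumes "form d f" "f (vector [0, 0, 1]) \<noteq> 0" "reduced f"
  obtains c where "c \<noteq> 0" "\<And>a b p w. ev2 c a b \<noteq> 0 \<Longrightarrow> (\<And>w. poly p w = f (vector [a, b, w])) \<Longrightarrow>
    poly p w = 0 \<Longrightarrow> poly (pderiv p) w \<noteq> 0"
proof -
  obtain g where g: "\<And>a b w. ev3 g a b w = f (vector [a, b, w])"
    using form_ev3[OF assms(1)] by metis
  have "g \<noteq> 0"
    using assms(2) g[of 0 0 1] by (auto simp: ev3_def ev2_simps)
  from bezout_or_common_factor[OF this, of "pderiv g"] show ?thesis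
  proof (elim disjE exE conjE)
    fix a b c assume bezout: "c \<noteq> 0" "a * g + b * pderiv g = [:c:]"
    show ?thesis
    proof (rule that[OF bezout(1)])
      fix x y p w
      assume *: "ev2 c x y \<noteq> 0" "\<And>w. poly p w = f (vector [x, y, w])" "poly p w = 0"
      have "p = slice g x y"
        by (rule poly_ext) (simp add: * poly_slice g)
      moreover have "ev2 c x y = ev3 a x y w * ev3 g x y w + ev3 b x y w * ev3 (pderiv g) x y w"
        using arg_cong[OF bezout(2), of "\<lambda>p. ev3 p x y w"] by (simp add: ev3_simps)
      ultimately show "poly (pderiv p) w \<noteq> 0"
        using * by (auto simp: pderiv_slice poly_slice)
    qed
  next
    fix r assume factor: "prime_elem r" "degree r > 0" "r dvd g" "r dvd pderiv g"
    then have "r ^ 2 dvd g" by (rule prime_dvd_pderiv_imp_square_dvd)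
    then obtain k where k: "g = r ^ 2 * k" by blast
    define X where "X z = ev3 r (z $ 1) (z $ 2) (z $ 3)" for z :: "complex^3"
    define K where "K z = ev3 k (z $ 1) (z $ 2) (z $ 3)" for z :: "complex^3"
    have XK: "polyfun X" "polyfun K"
      unfolding X_def K_def by (intro polyfun_ev3 polyfun_coord)+
    have "f z = X z ^ 2 * K z" for z
    proof -
      have "z = vector [z $ 1, z $ 2, z $ 3]"
        by (simp add: vec_eq_iff forall_3)
      then have "f z = ev3 g (z $ 1) (z $ 2) (z $ 3)"
        using g by metis
      then show ?thesis by (simp add: k X_def K_def ev3_simps)
    qed
    then have nz: "X z \<noteq> 0" for z
      using assms(3) XK unfolding reduced_def by blast
    \<comment> \<open>Where the leading coefficient of \<open>r\<close> does not vanish, the slice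
      of \<open>r\<close> keeps its positive degree and has a root, at which \<open>X\<close> would
      be zero.\<close>
    obtain a b where ab: "ev2 (lead_coeff r) a b \<noteq> 0"
      using factor(2) by (metis ev2_nonzero degree_0 leading_coeff_0_iff less_irrefl)
    then have "coeff (slice r a b) (degree r) \<noteq> 0"
      by (simp add: slice_def coeff_map_poly ev2_simps)
    then have "degree r \<le> degree (slice r a b)"
      by (rule le_degree)
    with factor(2) obtain w where "poly (slice r a b) w = 0"
      using alg_closed_imp_poly_has_root[of "slice r a b"] by auto
    then have "X (vector [a, b, w]) = 0"
      by (simp add: X_def poly_slice)
    with nz show ?thesis by blast
  qed
qed

section \<open>Continuity of roots\<close>

lemma poly_add_root: "poly ([:- a, 1:] * p) w = (w - a) * poly p (w :: complex)"
  by (simp add: algebra_simps)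

lemma prod_roots_ge:
  assumes "0 \<le> m" "\<And>x. x \<in># A \<Longrightarrow> m \<le> norm (w - x)"
  shows "m ^ size A \<le> norm (poly (\<Prod>x\<in>#A. [:- x, 1:]) (w :: complex))"
  using assms(2)
proof (induction A)
  case (add a A)
  then show ?case
    unfolding image_mset_add_mset prod_mset.add_mset poly_add_root norm_mult size_add_mset power_Suc
    using assms(1) by (intro mult_mono) auto
qed simp

lemma prod_roots_le:
  assumes "\<And>x. x \<in># A \<Longrightarrow> norm (w - x) \<le> m"
  shows "norm (poly (\<Prod>x\<in>#A. [:- x, 1:]) (w :: complex)) \<le> m ^ size A"
  using assms
proof (induction A)
  case (add a A)
  have "norm (w - a) \<le> m" using add.prems by simp
  then have "0 \<le> m" using norm_ge_zero[of "w - a"] by linarith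
  with add show ?case
    unfolding image_mset_add_mset prod_mset.add_mset poly_add_root norm_mult size_add_mset power_Suc
    by (intro mult_mono) auto
qed simp

text \<open>\<open>norm (poly p w)\<close> is the norm of the leading coefficient times the product
  of the distances from \<open>w\<close> to the roots. The nearest root gives the first bound, used
  for continuity of roots; the farthest gives the second, used for escape to infinity.\<close>

lemma
  fixes p :: "complex poly"
  assumes "degree p > 0"
  shows root_near: "\<exists>x. poly p x = 0 \<and> norm (lead_coeff p) * norm (w - x) ^ degree p \<le> norm (poly p w)"
    and root_far: "\<exists>x. poly p x = 0 \<and> norm (poly p w) \<le> norm (lead_coeff p) * norm (w - x) ^ degree p"
proof -
  obtain A where A: "size A = degree p" "p = smult (lead_coeff p) (\<Prod>x\<in>#A. [:- x, 1:])"
    using alg_closed_imp_factorization[of p] assms by (metis degree_0 less_irrefl)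
  let ?P = "\<Prod>x\<in>#A. [:- x, 1:]"
  have p: "norm (poly p w) = norm (lead_coeff p) * norm (poly ?P w)"
    by (subst A(2)) (simp add: norm_mult)
  have root: "poly p x = 0" if "x \<in># A" for x
  proof -
    have "[:- x, 1:] dvd ?P" using that by (simp add: dvd_prod_mset)
    then have "[:- x, 1:] dvd p" by (subst A(2)) (rule dvd_smult)
    then show ?thesis by (simp add: poly_eq_0_iff_dvd)
  qed
  have fin: "finite ((\<lambda>x. norm (w - x)) ` set_mset A)" "(\<lambda>x. norm (w - x)) ` set_mset A \<noteq> {}"
    using A(1) assms by auto
  obtain x where x: "x \<in># A" "norm (w - x) = Min ((\<lambda>x. norm (w - x)) ` set_mset A)"
    using Min_in[OF fin] by auto
  have "norm (w - x) ^ degree p \<le> norm (poly ?P w)"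
    unfolding A(1)[symmetric] using x fin by (intro prod_roots_ge) auto
  then show "\<exists>x. poly p x = 0 \<and> norm (lead_coeff p) * norm (w - x) ^ degree p \<le> norm (poly p w)"
    using root[OF x(1)] p by (metis mult_left_mono norm_ge_zero)
  obtain x where x: "x \<in># A" "norm (w - x) = Max ((\<lambda>x. norm (w - x)) ` set_mset A)"
    using Max_in[OF fin] by auto
  have "norm (poly ?P w) \<le> norm (w - x) ^ degree p"
    unfolding A(1)[symmetric] using x fin by (intro prod_roots_le) auto
  then show "\<exists>x. poly p x = 0 \<and> norm (poly p w) \<le> norm (lead_coeff p) * norm (w - x) ^ degree p"
    using root[OF x(1)] p by (metis mult_left_mono norm_ge_zero)
qed

lemma tendsto_0_power_imp:
  fixes u :: "'a \<Rightarrow> complex"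
  assumes "d > 0" "((\<lambda>t. norm (u t) ^ d) \<longlongrightarrow> 0) F"
  shows "(u \<longlongrightarrow> 0) F"
proof -
  have "((\<lambda>t. root d (norm (u t) ^ d)) \<longlongrightarrow> root d 0) F"
    by (rule tendsto_real_root[OF assms(2)])
  then show ?thesis
    using assms(1) by (simp add: real_root_pos2 tendsto_norm_zero_iff)
qed

lemma tendsto_vector_3:
  fixes a b c :: "'a \<Rightarrow> complex"
  assumes "(a \<longlongrightarrow> a') F" "(b \<longlongrightarrow> b') F" "(c \<longlongrightarrow> c') F"
  shows "((\<lambda>t. vector [a t, b t, c t] :: complex^3) \<longlongrightarrow> vector [a', b', c']) F"
proof (rule vec_tendstoI)
  show "((\<lambda>t. (vector [a t, b t, c t] :: complex^3) $ i) \<longlongrightarrow> (vector [a', b', c'] :: complex^3) $ i) F" for i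
    using exhaust_3[of i] assms by auto
qed

lemma no_root_imp_const:
  fixes q :: "complex poly"
  assumes "\<And>t. poly q t \<noteq> 0"
  shows "poly q s = poly q t"
proof -
  have "degree q = 0"
    using assms alg_closed_imp_poly_has_root[of q] by auto
  then show ?thesis by (auto elim: degree_eq_zeroE)
qed

lemma form_compose_3:
  fixes f :: "complex^3 \<Rightarrow> complex"
  assumes "form d f" "form e a" "form e b" "form e c"
  shows "form (d * e) (\<lambda>x. f (vector [a x, b x, c x]))"
proof -
  let ?g = "\<lambda>i::3. if i = 1 then a else if i = 2 then b else c"
  have "vector [a x, b x, c x] = (\<chi> i::3. ?g i x)" for x
    by (simp add: vec_eq_iff forall_3)
  then show ?thesis
    using form_compose[OF assms(1), of e ?g] assms(2-) by simp
qed

lemma form_compose_2: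
  fixes f :: "complex^2 \<Rightarrow> complex"
  assumes "form d f" "form e a" "form e b"
  shows "form (d * e) (\<lambda>x. f (vector [a x, b x]))"
proof -
  let ?g = "\<lambda>i::2. if i = 1 then a else b"
  have "vector [a x, b x] = (\<chi> i::2. ?g i x)" for x
    by (simp add: vec_eq_iff forall_2)
  then show ?thesis
    using form_compose[OF assms(1), of e ?g] assms(2-) by simp
qed

section \<open>The equation of the transformed curve\<close>

definition base :: "complex^3 \<Rightarrow> complex^2" where
  "base z = vector [z $ 1, z $ 2]"

definition lift :: "complex^2 \<Rightarrow> complex \<Rightarrow> complex^3" where
  "lift x w = vector [x $ 1, x $ 2, w]"

lemma base_lift [simp]: "base (lift x w) = x"
  by (simp add: base_def lift_def vec_eq_iff forall_2)

lemma lift_nth [simp]: "lift x w $ 1 = x $ 1" "lift x w $ 2 = x $ 2" "lift x w $ 3 = w"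
  by (simp_all add: lift_def)

lemma base_nth [simp]: "base z $ 1 = z $ 1" "base z $ 2 = z $ 2"
  by (simp_all add: base_def)

lemma lift_base [simp]: "lift (base z) (z $ 3) = z"
  by (simp add: vec_eq_iff forall_3)

lemma scale_lift: "c *s lift x w = lift (c *s x) (c * w)"
  by (simp add: vec_eq_iff forall_3)

lemma form_base: "form d f \<Longrightarrow> form d (\<lambda>z. f (base z))"
  unfolding base_def using form_compose_2[OF _ form_coord form_coord] by simp

lemma tendsto_lift:
  assumes "(X \<longlongrightarrow> x) F" "(W \<longlongrightarrow> w) F"
  shows "((\<lambda>t. lift (X t) (W t)) \<longlongrightarrow> lift x w) F"
  unfolding lift_def by (intro tendsto_vector_3 tendsto_vec_nth assms)

text \<open>In the coordinates \<open>z = (x, w)\<close> the Cremona transformation is \<open>(x, w) \<mapsto> (l x, h w - p)\<close> with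
  inverse \<open>(x, w) \<mapsto> (h x, l w + p)\<close>.\<close>

locale transformation =
  fixes f :: "complex^3 \<Rightarrow> complex" and d N :: nat and h l p :: "complex^2 \<Rightarrow> complex"
  assumes f: "form d f" and d: "d > 0" and f_centre: "f (lift 0 1) \<noteq> 0"
    and h: "form N h" and l: "form N l" and p: "form (Suc N) p"
    and h_nz: "\<exists>x. h x \<noteq> 0" and l_nz: "\<exists>x. l x \<noteq> 0"
    and l_zero: "N > 0 \<Longrightarrow> \<exists>x. x \<noteq> 0 \<and> l x = 0"
    and centre: "x \<noteq> 0 \<Longrightarrow> l x = 0 \<Longrightarrow> f (lift (h x *s x) (p x)) \<noteq> 0"
begin

definition pull :: "complex^3 \<Rightarrow> complex^3" where
  "pull z = lift (h (base z) *s base z) (l (base z) * z $ 3 + p (base z))"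

definition g :: "complex^3 \<Rightarrow> complex" where
  "g z = f (pull z)"

text \<open>The source of the degree: the three coordinates of \<open>pull\<close> are forms of
  degree \<open>N + 1\<close>, substituted into a form of degree \<open>d\<close>.\<close>

lemma form_g: "form (d * (N + 1)) g"
proof -
  have "form (N + 1) (\<lambda>z. h (base z) * z $ i)" for i
    by (intro form_mult form_base h form_coord)
  moreover have "form (N + 1) (\<lambda>z. l (base z) * z $ 3 + p (base z))"
    using form_mult[OF form_base[OF l] form_coord, of 3] form_base[OF p]
    by (intro form_add) auto
  ultimately have "form (d * (N + 1)) (\<lambda>z. f (vector [h (base z) * z $ 1, h (base z) * z $ 2,
      l (base z) * z $ 3 + p (base z)]))"
    by (intro form_compose_3[OF f])
  then show ?thesis
    unfolding g_def pull_def lift_def by simp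
qed

text \<open>On this fibre \<open>g\<close> is a slice of \<open>f\<close> composed with an affine
  map of slope \<open>l x\<close>. Since \<open>f\<close> does not vanish at the centre, the slice
  of \<open>f\<close> has degree exactly \<open>d\<close>, even where
  \<open>h x = 0\<close>.\<close>

lemma slice_g:
  assumes "l x \<noteq> 0"
  obtains q where "\<And>w. poly q w = g (lift x w)" "degree q = d"
    "lead_coeff q = f (lift 0 1) * l x ^ d"
proof -
  obtain s where s: "\<And>w. poly s w = f (lift (h x *s x) w)" "degree s \<le> d"
    "coeff s d = f (lift 0 1)"
    using form_slice[OF f, of "(h x *s x) $ 1" "(h x *s x) $ 2"] unfolding lift_def
    by (metis zero_index)
  have deg: "degree s = d"
    using s f_centre le_degree[of s d] by simp
  define q where "q = pcompose s [:p x, l x:]"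
  have "poly q w = g (lift x w)" for w
    by (simp add: q_def poly_pcompose s g_def pull_def algebra_simps)
  moreover have "degree q = d"
    using assms by (simp add: q_def degree_pcompose deg)
  moreover have "lead_coeff q = f (lift 0 1) * l x ^ d"
    unfolding q_def using assms s(3) by (subst lead_coeff_comp) (simp_all add: deg)
  ultimately show ?thesis by (rule that)
qed

text \<open>\<open>X\<close> runs along the line from \<open>x\<close> to a point where
  \<open>h\<close> and \<open>l\<close> are both nonzero; their product has only finitely many zeros
  on it, which a punctured neighbourhood of 0 avoids.\<close>

lemma approach:
  assumes "x \<noteq> 0"
  obtains X where "(X \<longlongrightarrow> x) (at (0::complex))"
    "\<forall>\<^sub>F t in at 0. X t \<noteq> 0 \<and> h (X t) \<noteq> 0 \<and> l (X t) \<noteq> 0"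
proof -
  have ph: "polyfun h" and pl: "polyfun l" using h l form_imp_polyfun by auto
  obtain a where a: "h a * l a \<noteq> 0"
    using polyfun_mult_eq_0[OF ph pl] h_nz l_nz by metis
  obtain q where q: "\<And>t. poly q t = h (x + t *s (a - x)) * l (x + t *s (a - x))"
    using polyfun_line[OF polyfun_mult[OF ph pl], of x "a - x"] by blast
  have "poly q 1 \<noteq> 0" using a by (simp add: q)
  then have "finite {t. poly q t = 0}" by (intro poly_roots_finite) auto
  then have qn: "\<forall>\<^sub>F t in at 0. poly q t \<noteq> 0"
    using islimpt_finite[of "{t. poly q t = 0}" 0]
    by (simp add: islimpt_iff_eventually)
  have lim: "((\<lambda>t. x + t *s (a - x)) \<longlongrightarrow> x) (at 0)"
    by (rule vec_tendstoI) (auto intro!: tendsto_eq_intros)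
  from qn tendsto_imp_eventually_ne[OF lim assms]
  have "\<forall>\<^sub>F t in at 0. x + t *s (a - x) \<noteq> 0 \<and> h (x + t *s (a - x)) \<noteq> 0 \<and> l (x + t *s (a - x)) \<noteq> 0"
    by eventually_elim (simp add: q)
  with lim show ?thesis by (rule that)
qed

text \<open>The roots \<open>w\<close> of \<open>g (x, w)\<close> depend continuously on \<open>x\<close> as long as \<open>l x \<noteq> 0\<close>, and one of them tends
  to infinity when \<open>x\<close> approaches a zero of \<open>l\<close>.\<close>

lemma vanishing_near:
  assumes K: "polyfun K"
    and van: "\<And>z. g z = 0 \<Longrightarrow> base z \<noteq> 0 \<Longrightarrow> h (base z) \<noteq> 0 \<Longrightarrow> l (base z) \<noteq> 0 \<Longrightarrow> K z = 0"
    and x: "x \<noteq> 0" "l x \<noteq> 0" "g (lift x w) = 0"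
  shows "K (lift x w) = 0"
proof -
  obtain X where X: "(X \<longlongrightarrow> x) (at (0::complex))"
    "\<forall>\<^sub>F t in at 0. X t \<noteq> 0 \<and> h (X t) \<noteq> 0 \<and> l (X t) \<noteq> 0"
    using approach[OF x(1)] by blast
  let ?c = "f (lift 0 1)"
  \<comment> \<open>\<open>v\<close> is the root nearest to \<open>w\<close> on the fibre over
    \<open>X t\<close>. The implication makes the choice of \<open>V\<close> possible for every
    \<open>t\<close>.\<close>
  have "\<exists>v. l (X t) \<noteq> 0 \<longrightarrow> g (lift (X t) v) = 0 \<and>
      norm (w - v) ^ d \<le> norm (g (lift (X t) w)) / norm (?c * l (X t) ^ d)" for t
  proof (cases "l (X t) = 0")
    case False
    obtain q where q: "\<And>w. poly q w = g (lift (X t) w)" "degree q = d"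
      "lead_coeff q = ?c * l (X t) ^ d"
      using slice_g[OF False] by blast
    have "norm (?c * l (X t) ^ d) > 0" using False f_centre by simp
    with root_near[of q w] q d show ?thesis
      by (simp add: field_simps)
  qed simp
  then obtain V where V: "\<And>t. l (X t) \<noteq> 0 \<Longrightarrow> g (lift (X t) (V t)) = 0"
    "\<And>t. l (X t) \<noteq> 0 \<Longrightarrow> norm (w - V t) ^ d \<le> norm (g (lift (X t) w)) / norm (?c * l (X t) ^ d)"
    by metis
  have "((\<lambda>t. g (lift (X t) w)) \<longlongrightarrow> g (lift x w)) (at 0)"
    by (intro polyfun_tendsto[OF form_imp_polyfun[OF form_g]] tendsto_lift X tendsto_const)
  moreover have "((\<lambda>t. l (X t)) \<longlongrightarrow> l x) (at 0)"
    by (intro polyfun_tendsto[OF form_imp_polyfun[OF l]] X)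
  ultimately have "((\<lambda>t. norm (g (lift (X t) w)) / norm (?c * l (X t) ^ d)) \<longlongrightarrow>
      norm (g (lift x w)) / norm (?c * l x ^ d)) (at 0)"
    using f_centre x(2) by (intro tendsto_intros) auto
  then have lim: "((\<lambda>t. norm (g (lift (X t) w)) / norm (?c * l (X t) ^ d)) \<longlongrightarrow> 0) (at 0)"
    using x(3) by simp
  have "((\<lambda>t. norm (w - V t) ^ d) \<longlongrightarrow> 0) (at 0)"
    by (rule tendsto_sandwich[OF _ _ tendsto_const lim])
      (use X(2) V(2) in \<open>auto elim!: eventually_mono\<close>)
  then have "((\<lambda>t. w - V t) \<longlongrightarrow> 0) (at 0)"
    by (rule tendsto_0_power_imp[OF d])
  then have "((\<lambda>t. w - (w - V t)) \<longlongrightarrow> w - 0) (at 0)"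
    by (intro tendsto_intros)
  then have "((\<lambda>t. K (lift (X t) (V t))) \<longlongrightarrow> K (lift x w)) (at 0)"
    by (intro polyfun_tendsto[OF K] tendsto_lift X) simp
  moreover have "((\<lambda>t. K (lift (X t) (V t))) \<longlongrightarrow> 0) (at 0)"
    by (rule tendsto_eventually) (use X(2) V(1) van in \<open>auto elim!: eventually_mono\<close>)
  ultimately show ?thesis
    by (intro tendsto_unique[of "at (0::complex)"]) auto
qed

lemma vanishing_far:
  assumes K: "form e K"
    and van: "\<And>z. g z = 0 \<Longrightarrow> base z \<noteq> 0 \<Longrightarrow> h (base z) \<noteq> 0 \<Longrightarrow> l (base z) \<noteq> 0 \<Longrightarrow> K z = 0"
    and N: "N > 0"
  shows "K (lift 0 1) = 0"
proof -
  obtain r where r: "r \<noteq> 0" "l r = 0" using l_zero[OF N] by blast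
  obtain X where X: "(X \<longlongrightarrow> r) (at (0::complex))"
    "\<forall>\<^sub>F t in at 0. X t \<noteq> 0 \<and> h (X t) \<noteq> 0 \<and> l (X t) \<noteq> 0"
    using approach[OF r(1)] by blast
  let ?c = "f (lift 0 1)"
  have gr: "g (lift r 0) \<noteq> 0"
    using centre[OF r] by (simp add: g_def pull_def)
  have limg: "((\<lambda>t. g (lift (X t) 0)) \<longlongrightarrow> g (lift r 0)) (at 0)"
    by (intro polyfun_tendsto[OF form_imp_polyfun[OF form_g]] tendsto_lift X tendsto_const)
  have liml: "((\<lambda>t. l (X t)) \<longlongrightarrow> l r) (at 0)"
    by (intro polyfun_tendsto[OF form_imp_polyfun[OF l]] X)
  have good: "\<forall>\<^sub>F t in at 0. X t \<noteq> 0 \<and> h (X t) \<noteq> 0 \<and> l (X t) \<noteq> 0 \<and> g (lift (X t) 0) \<noteq> 0"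
    using X(2) tendsto_imp_eventually_ne[OF limg gr] by eventually_elim auto
  \<comment> \<open>\<open>v\<close> is the root farthest from 0. Its reciprocal is bounded by the
    leading coefficient over the value at \<open>w = 0\<close>; as \<open>X t\<close> tends to
    \<open>r\<close>, the former tends to 0 and the latter does not.\<close>
  have "\<exists>v. l (X t) \<noteq> 0 \<and> g (lift (X t) 0) \<noteq> 0 \<longrightarrow> g (lift (X t) v) = 0 \<and> v \<noteq> 0 \<and>
      norm (1 / v) ^ d \<le> norm (?c * l (X t) ^ d) / norm (g (lift (X t) 0))" for t
  proof (cases "l (X t) \<noteq> 0 \<and> g (lift (X t) 0) \<noteq> 0")
    case True
    obtain q where q: "\<And>w. poly q w = g (lift (X t) w)" "degree q = d"
      "lead_coeff q = ?c * l (X t) ^ d"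
      using slice_g True by blast
    obtain v where v: "poly q v = 0" "norm (poly q 0) \<le> norm (lead_coeff q) * norm (0 - v) ^ degree q"
      using root_far[of q 0] q d by auto
    have "v \<noteq> 0" using True v(1) q(1) by auto
    with v True show ?thesis
      by (intro exI[of _ v]) (auto simp: q q(3)[unfolded q(2)] norm_divide power_divide field_simps)
  next
    case False
    then show ?thesis by blast
  qed
  then obtain V where V: "\<And>t. l (X t) \<noteq> 0 \<Longrightarrow> g (lift (X t) 0) \<noteq> 0 \<Longrightarrow> g (lift (X t) (V t)) = 0 \<and> V t \<noteq> 0"
    "\<And>t. l (X t) \<noteq> 0 \<Longrightarrow> g (lift (X t) 0) \<noteq> 0 \<Longrightarrow> 
      norm (1 / V t) ^ d \<le> norm (?c * l (X t) ^ d) / norm (g (lift (X t) 0))"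
    by metis
  have "((\<lambda>t. norm (?c * l (X t) ^ d) / norm (g (lift (X t) 0))) \<longlongrightarrow>
      norm (?c * l r ^ d) / norm (g (lift r 0))) (at 0)"
    using gr by (intro tendsto_intros limg liml) auto
  then have lim: "((\<lambda>t. norm (?c * l (X t) ^ d) / norm (g (lift (X t) 0))) \<longlongrightarrow> 0) (at 0)"
    using r(2) d by (simp add: power_0_left)
  have "((\<lambda>t. norm (1 / V t) ^ d) \<longlongrightarrow> 0) (at 0)"
    by (rule tendsto_sandwich[OF _ _ tendsto_const lim])
      (use good V(2) in \<open>auto elim!: eventually_mono\<close>)
  then have limV: "((\<lambda>t. 1 / V t) \<longlongrightarrow> 0) (at 0)"
    by (rule tendsto_0_power_imp[OF d])
  \<comment> \<open>In homogeneous coordinates, dividing by \<open>V t\<close> turns the escape to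
    infinity into convergence to \<open>(0 : 0 : 1)\<close>; zeros of the form \<open>K\<close>
    survive this scaling.\<close>
  have "((\<lambda>t. (1 / V t) *s X t) \<longlongrightarrow> 0 *s r) (at 0)"
  proof (rule vec_tendstoI)
    show "((\<lambda>t. ((1 / V t) *s X t) $ i) \<longlongrightarrow> (0 *s r) $ i) (at 0)" for i
      using tendsto_mult[OF limV tendsto_vec_nth[OF X(1), of i]] by simp
  qed
  then have "((\<lambda>t. K (lift ((1 / V t) *s X t) 1)) \<longlongrightarrow> K (lift 0 1)) (at 0)"
    by (intro polyfun_tendsto[OF form_imp_polyfun[OF K]] tendsto_lift tendsto_const) simp
  moreover have "((\<lambda>t. K (lift ((1 / V t) *s X t) 1)) \<longlongrightarrow> 0) (at 0)"
  proof (rule tendsto_eventually, use good in eventually_elim)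
    fix t assume t: "X t \<noteq> 0 \<and> h (X t) \<noteq> 0 \<and> l (X t) \<noteq> 0 \<and> g (lift (X t) 0) \<noteq> 0"
    then have "K (lift (X t) (V t)) = 0" using V(1) by (intro van) auto
    then have "K ((1 / V t) *s lift (X t) (V t)) = 0" by (simp add: form_scale[OF K])
    then show "K (lift ((1 / V t) *s X t) 1) = 0"
      using V(1) t by (simp add: scale_lift)
  qed
  ultimately show ?thesis
    by (intro tendsto_unique[of "at (0::complex)"]) auto
qed

text \<open>The zero set of \<open>g\<close> adds only limit points to its part over
  \<open>h\<close> and \<open>l\<close> nonzero. Over a nonzero base point with \<open>l = 0\<close>
  there is no zero at all; \<open>(0 : 0 : 1)\<close> is a limit when \<open>N > 0\<close> and off
  the curve when \<open>N = 0\<close>.\<close>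

lemma vanishing:
  assumes K: "form e K"
    and van: "\<And>z. g z = 0 \<Longrightarrow> base z \<noteq> 0 \<Longrightarrow> h (base z) \<noteq> 0 \<Longrightarrow> l (base z) \<noteq> 0 \<Longrightarrow> K z = 0"
    and z: "z \<noteq> 0" "g z = 0"
  shows "K z = 0"
proof -
  consider "base z \<noteq> 0" "l (base z) \<noteq> 0" | "base z \<noteq> 0" "l (base z) = 0"
    | "base z = 0" "N > 0" | "base z = 0" "N = 0" by blast
  then show ?thesis
  proof cases
    case 1
    with vanishing_near[OF form_imp_polyfun[OF K] van 1, of "z $ 3"] z show ?thesis by simp
  next
    case 2
    with centre[OF 2] z show ?thesis by (simp add: g_def pull_def)
  next
    case 3
    have "z = (z $ 3) *s lift 0 1"
      using lift_base[of z] 3(1) by (simp add: scale_lift)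
    then have "K z = (z $ 3) ^ e * K (lift 0 1)"
      using form_scale[OF K] by metis
    with vanishing_far[OF K van 3(2)] show ?thesis by simp
  next
    case 4
    obtain x where "l x \<noteq> 0" using l_nz by blast
    \<comment> \<open>For \<open>N = 0\<close> the scaling law with factor 0 reads
      \<open>l 0 = l x\<close>, because \<open>0 ^ 0 = 1\<close>.\<close>
    then have "l 0 \<noteq> 0" using form_scale[OF l, of 0 x] 4 by simp
    moreover have "z $ 3 \<noteq> 0"
    proof
      assume "z $ 3 = 0"
      then have "z = lift 0 0" using lift_base[of z] 4(1) by simp
      also have "\<dots> = 0" by (simp add: vec_eq_iff forall_3)
      finally show False using z(1) by simp
    qed
    moreover have "p 0 = 0" using form_scale[OF p, of 0 0] by simp
    then have "g z = f ((l 0 * z $ 3) *s lift 0 1)"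
      using 4 by (simp add: g_def pull_def scale_lift)
    then have "g z = (l 0 * z $ 3) ^ d * f (lift 0 1)"
      by (simp add: form_scale[OF f])
    ultimately show ?thesis using z(2) f_centre by simp
  qed
qed

text \<open>Simple roots on general fibres make \<open>X\<close> independent of \<open>w\<close>
  there, and cancellation extends this to all fibres. Then \<open>X\<close> has no zeros over
  nonzero base points, so it is constant on every line that stays over such points.\<close>

lemma square_factor_const:
  assumes red: "reduced f"
    and X: "polyfun X" and K: "polyfun K" and XK: "\<And>z. g z = X z ^ 2 * K z"
  obtains c where "c \<noteq> 0" "\<And>z. X z = c"
proof -
  obtain c where c: "c \<noteq> 0" "\<And>a b q w. ev2 c a b \<noteq> 0 \<Longrightarrow> (\<And>w. poly q w = f (vector [a, b, w])) \<Longrightarrow>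
    poly q w = 0 \<Longrightarrow> poly (pderiv q) w \<noteq> 0"
    using reduced_form_generic_slice[OF f _ red] f_centre unfolding lift_def by (metis zero_index)
  have const: "X (lift x w) = X (lift x 0)"
    if x: "ev2 c (x $ 1) (x $ 2) \<noteq> 0" "h x \<noteq> 0" "l x \<noteq> 0" for x w
  proof -
    have line: "lift x 0 + t *s lift 0 1 = lift x t" for t
      by (simp add: vec_eq_iff forall_3)
    obtain \<xi> where \<xi>: "\<And>t. poly \<xi> t = X (lift x t)"
      using polyfun_line[OF X, of "lift x 0" "lift 0 1"] unfolding line by blast
    obtain \<kappa> where \<kappa>: "\<And>t. poly \<kappa> t = K (lift x t)"
      using polyfun_line[OF K, of "lift x 0" "lift 0 1"] unfolding line by blast
    obtain s where s: "\<And>w. poly s w = f (lift x w)"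
      using form_slice[OF f, of "x $ 1" "x $ 2"] unfolding lift_def by metis
    \<comment> \<open>Dividing by \<open>h x\<close> replaces the base point \<open>h x *s x\<close>
      by \<open>x\<close> itself, over which the roots of \<open>f\<close> are known to be simple;
      the factor \<open>h x ^ d\<close> comes from homogeneity.\<close>
    let ?q = "[:p x / h x, l x / h x:]"
    have eq: "smult (h x ^ d) (pcompose s ?q) = \<xi> ^ 2 * \<kappa>"
    proof (rule poly_ext)
      fix t
      have "g (lift x t) = f (h x *s lift x (poly ?q t))"
        using x by (simp add: g_def pull_def scale_lift field_simps)
      then show "poly (smult (h x ^ d) (pcompose s ?q)) t = poly (\<xi> ^ 2 * \<kappa>) t"
        using XK[of "lift x t"] by (simp add: poly_pcompose s \<xi> \<kappa> form_scale[OF f])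
    qed
    have "poly \<xi> t \<noteq> 0" for t
    proof
      assume \<xi>0: "poly \<xi> t = 0"
      have "poly (smult (h x ^ d) (pcompose s ?q)) t = 0"
        unfolding eq using \<xi>0 by simp
      then have "poly s (poly ?q t) = 0"
        using x by (simp add: poly_pcompose)
      moreover have "poly (pderiv (smult (h x ^ d) (pcompose s ?q))) t = 0"
        unfolding eq using \<xi>0 by (simp add: power2_eq_square pderiv_mult)
      then have "poly (pderiv s) (poly ?q t) = 0"
        using x by (simp add: pderiv_smult pderiv_pcompose poly_pcompose pderiv_pCons)
      ultimately show False
        using c(2)[OF x(1), of s "poly ?q t"] s by (simp add: lift_def)
    qed
    from no_root_imp_const[OF this, of w 0] show ?thesis by (simp add: \<xi>)
  qed
  \<comment> \<open>The identity is known off the zeros of three nonzero polynomials. Multiplied by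
    them it holds everywhere, and they are then cancelled one at a time.\<close>
  have X_base: "X z = X (lift (base z) 0)" for z
  proof -
    let ?D = "\<lambda>z. X z - X (lift (base z) 0)"
    have pD: "polyfun ?D"
    proof -
      have "polyfun (\<lambda>z. X (lift (base z) 0))"
      proof -
        let ?v = "\<lambda>i::3. if i = 1 then (\<lambda>z::complex^3. z $ 1) else if i = 2 then (\<lambda>z. z $ 2) else (\<lambda>z. 0)"
        have "lift (base z) 0 = (\<chi> i. ?v i z)" for z
          by (simp add: vec_eq_iff forall_3)
        moreover have "polyfun (\<lambda>z. X (\<chi> i. ?v i z))"
          by (rule polyfun_compose[OF X]) (auto intro: polyfun_coord polyfun_const)
        ultimately show ?thesis by simp
      qed
      then show ?thesis by (rule polyfun_diff[OF X])
    qed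
    have pc: "polyfun (\<lambda>z::complex^3. ev2 c (z $ 1) (z $ 2))"
      by (intro polyfun_ev2 polyfun_coord)
    have ph: "polyfun (\<lambda>z. h (base z))" and pl: "polyfun (\<lambda>z. l (base z))"
      using form_base[OF h] form_base[OF l] by (auto intro: form_imp_polyfun)
    obtain a b where ab: "ev2 c a b \<noteq> 0" using ev2_nonzero[OF c(1)] by blast
    obtain h0 where "h h0 \<noteq> 0" using h_nz by blast
    obtain l0 where "l l0 \<noteq> 0" using l_nz by blast
    have D: "ev2 c (z $ 1) (z $ 2) * (h (base z) * (l (base z) * ?D z)) = 0" for z
      using const[of "base z" "z $ 3"] by auto
    have D1: "h (base z) * (l (base z) * ?D z) = 0" for z
      by (rule polyfun_mult_eq_0[where f = "\<lambda>z. ev2 c (z $ 1) (z $ 2)" and a = "lift (vector [a, b]) 0"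
        and g = "\<lambda>z. h (base z) * (l (base z) * ?D z)", OF pc _ D])
        (use ab in \<open>simp_all add: polyfun_mult ph pl pD\<close>)
    have D2: "l (base z) * ?D z = 0" for z
      by (rule polyfun_mult_eq_0[where f = "\<lambda>z. h (base z)" and a = "lift h0 0"
        and g = "\<lambda>z. l (base z) * ?D z", OF ph _ D1])
        (use \<open>h h0 \<noteq> 0\<close> in \<open>simp_all add: polyfun_mult pl pD\<close>)
    have "?D z = 0"
      by (rule polyfun_mult_eq_0[where f = "\<lambda>z. l (base z)" and a = "lift l0 0" and g = ?D, OF pl pD D2])
        (use \<open>l l0 \<noteq> 0\<close> in simp)
    then show ?thesis by simp
  qed
  \<comment> \<open>As \<open>X\<close> does not depend on \<open>w\<close>, one zero would make
    \<open>g\<close> vanish on the whole fibre, against \<open>centre\<close> if \<open>l\<close> is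
    zero there and against the degree \<open>d\<close> of \<open>g\<close> in \<open>w\<close>
    otherwise.\<close>
  have nz: "X z \<noteq> 0" if "base z \<noteq> 0" for z
  proof
    assume "X z = 0"
    then have "X (lift (base z) w) = 0" for w
      using X_base[of "lift (base z) w"] X_base[of z] by simp
    then have g0: "g (lift (base z) w) = 0" for w by (simp add: XK)
    show False
    proof (cases "l (base z) = 0")
      case True
      with g0[of 0] centre[OF that] show ?thesis by (simp add: g_def pull_def)
    next
      case False
      obtain q where q: "\<And>w. poly q w = g (lift (base z) w)" "degree q = d"
        using slice_g[OF False] by blast
      then have "q = 0" using g0 by (intro poly_ext) simp
      with q d show ?thesis by simp
    qed
  qed
  let ?e = "vector [1, 0, 0] :: complex^3"
  have X_e: "X z = X ?e" if "z $ 2 \<noteq> 0" for z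
  proof -
    obtain q where q: "\<And>t. poly q t = X (?e + t *s (z - ?e))"
      using polyfun_line[OF X, of ?e "z - ?e"] by blast
    \<comment> \<open>The line from \<open>?e\<close> to \<open>z\<close> stays over nonzero base
      points: at \<open>t = 0\<close> the first coordinate is 1, and elsewhere the second is
      nonzero.\<close>
    have "poly q t \<noteq> 0" for t
      unfolding q using that by (intro nz) (auto simp: vec_eq_iff forall_2)
    from no_root_imp_const[OF this, of 1 0] show ?thesis by (simp add: q)
  qed
  have D: "z $ 2 * (X z - X ?e) = 0" for z
    using X_e[of z] by auto
  have "X z = X ?e" for z
  proof -
    have "X z - X ?e = 0"
      by (rule polyfun_mult_eq_0[where f = "\<lambda>z. z $ 2" and a = "vector [0, 1, 0]"
        and g = "\<lambda>z. X z - X ?e", OF polyfun_coord polyfun_diff[OF X polyfun_const] D]) simp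
    then show ?thesis by simp
  qed
  moreover have "X ?e \<noteq> 0"
    by (rule nz) (auto simp: vec_eq_iff forall_2)
  ultimately show ?thesis using that by blast
qed

end

section \<open>The two maps are mutually inverse up to scalars\<close>

context transformation
begin

text \<open>\<open>pull\<close> after the forward map multiplies all coordinates by
  \<open>l x ^ Suc N * h x\<close>, since \<open>h\<close> and \<open>l\<close> have degree
  \<open>N\<close> and \<open>p\<close> has degree \<open>N + 1\<close>.\<close>

lemma g_push: "g (lift (l x *s x) (h x * w - p x)) = (l x ^ Suc N * h x) ^ d * f (lift x w)"
proof -
  have "pull (lift (l x *s x) (h x * w - p x)) = (l x ^ Suc N * h x) *s lift x w"
    by (simp add: pull_def scale_lift form_scale[OF h] form_scale[OF l] form_scale[OF p] algebra_simps)
  then show ?thesis by (simp add: g_def form_scale[OF f] del: power_Suc)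
qed

lemma push_pull:
  defines "x \<equiv> \<lambda>z. base (pull z)"
  shows "lift (l (x z) *s x z) (h (x z) * pull z $ 3 - p (x z)) =
    (h (base z) ^ Suc N * l (base z)) *s z"
proof -
  have "lift (l (x z) *s x z) (h (x z) * pull z $ 3 - p (x z)) =
      (h (base z) ^ Suc N * l (base z)) *s lift (base z) (z $ 3)"
    unfolding scale_lift
    by (simp add: x_def pull_def form_scale[OF h] form_scale[OF l] form_scale[OF p] algebra_simps)
  then show ?thesis by simp
qed

end

section \<open>The transformation in coordinates\<close>

lemma pt_eq_iff: "pt v = pt w \<longleftrightarrow> (\<exists>c. c \<noteq> 0 \<and> w = c *s v)"
proof
  assume "pt v = pt w"
  moreover have "w \<in> pt w" unfolding pt_def by (auto intro!: exI[of _ 1])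
  ultimately show "\<exists>c. c \<noteq> 0 \<and> w = c *s v" by (auto simp: pt_def)
next
  assume "\<exists>c. c \<noteq> 0 \<and> w = c *s v"
  then obtain c where c: "c \<noteq> 0" "w = c *s v" by blast
  have "\<exists>b. b *s w = a *s v \<and> b \<noteq> 0" if "a \<noteq> 0" for a
    using c that by (intro exI[of _ "a / c"]) simp
  moreover have "\<exists>b. a *s w = b *s v \<and> b \<noteq> 0" if "a \<noteq> 0" for a
    using c that by (intro exI[of _ "a * c"]) simp
  ultimately show "pt v = pt w" unfolding pt_def by (auto, metis+)
qed

lemma hpt_eq_iff:
  "hpt n (x, u, v) = hpt n (x', u', v') \<longleftrightarrow>
    (\<exists>c e. c \<noteq> 0 \<and> e \<noteq> 0 \<and> x' = c *s x \<and> u' = e * u / c ^ n \<and> v' = e * v)"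
proof
  assume eq: "hpt n (x, u, v) = hpt n (x', u', v')"
  have "(x', u', v') = (1 *s x', 1 * u' / 1 ^ n, 1 * v') \<and> (1::complex) \<noteq> 0 \<and> (1::complex) \<noteq> 0"
    by simp
  then have "(x', u', v') \<in> hpt n (x', u', v')"
    unfolding hpt_def by blast
  then have "(x', u', v') \<in> hpt n (x, u, v)"
    by (simp only: eq)
  then show "\<exists>c e. c \<noteq> 0 \<and> e \<noteq> 0 \<and> x' = c *s x \<and> u' = e * u / c ^ n \<and> v' = e * v"
    by (auto simp: hpt_def)
next
  assume "\<exists>c e. c \<noteq> 0 \<and> e \<noteq> 0 \<and> x' = c *s x \<and> u' = e * u / c ^ n \<and> v' = e * v"
  then obtain c e where ce: "c \<noteq> 0" "e \<noteq> 0" "x' = c *s x" "u' = e * u / c ^ n" "v' = e * v"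
    by blast
  show "hpt n (x, u, v) = hpt n (x', u', v')"
  proof (intro set_eqI iffI)
    fix t assume "t \<in> hpt n (x, u, v)"
    then obtain a b where ab: "a \<noteq> 0" "b \<noteq> 0" "t = (a *s x, b * u / a ^ n, b * v)"
      by (auto simp: hpt_def)
    then have "a / c \<noteq> 0 \<and> b / e \<noteq> 0 \<and> t = ((a / c) *s x', (b / e) * u' / (a / c) ^ n, (b / e) * v')"
      using ce by (simp add: power_divide)
    then show "t \<in> hpt n (x', u', v')" unfolding hpt_def case_prod_conv mem_Collect_eq by blast
  next
    fix t assume "t \<in> hpt n (x', u', v')"
    then obtain a b where ab: "a \<noteq> 0" "b \<noteq> 0" "t = (a *s x', b * u' / a ^ n, b * v')"
      by (auto simp: hpt_def)
    then have "a * c \<noteq> 0 \<and> b * e \<noteq> 0 \<and> t = ((a * c) *s x, (b * e) * u / (a * c) ^ n, (b * e) * v)"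
      using ce by (simp add: power_mult_distrib field_simps)
    then show "t \<in> hpt n (x, u, v)" unfolding hpt_def case_prod_conv mem_Collect_eq by blast
  qed
qed

lemma hpt_eqI:
  assumes "c \<noteq> 0" "e \<noteq> 0" "x' = c *s x" "u' = e * u / c ^ n" "v' = e * v"
  shows "hpt n (x, u, v) = hpt n (x', u', v')"
  using assms hpt_eq_iff by blast

lemma hpt_same_fibreD:
  assumes "hpt n (x, u, v) = hpt n (x, u', v')" "x \<noteq> 0"
  obtains e where "e \<noteq> 0" "u' = e * u" "v' = e * v"
proof -
  obtain c e where ce: "c \<noteq> 0" "e \<noteq> 0" "x = c *s x" "u' = e * u / c ^ n" "v' = e * v"
    using assms(1) hpt_eq_iff by blast
  obtain i where "x $ i \<noteq> 0" using assms(2) by (auto simp: vec_eq_iff)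
  moreover have "x $ i = c * x $ i" by (metis ce(3) vector_smult_component)
  ultimately have "c = 1" by simp
  with ce show ?thesis using that by simp
qed

section \<open>Fibrewise maps between Hirzebruch surfaces\<close>

definition homog :: "nat \<Rightarrow> (complex^2 \<Rightarrow> complex) \<Rightarrow> bool" where
  "homog k f \<longleftrightarrow> (\<forall>c x. f (c *s x) = c ^ k * f x)"

lemma form_imp_homog: "form k f \<Longrightarrow> homog k f"
  by (simp add: homog_def form_scale)

lemma fib_scale: "fib q (c *s x) = c * fib q x"
  by (simp add: fib_def algebra_simps)

lemma form_fib: "form 1 (fib q)"
  unfolding fib_def by (intro form_diff form_cmult form_coord)

text \<open>The common shape of all steps and of their composites: in the fibre coordinate
  \<open>w = v / u\<close> the map is \<open>w \<mapsto> (h w - p) / l\<close>, restricted to the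
  fibres where it is invertible.\<close>

definition graph ::
  "nat \<Rightarrow> nat \<Rightarrow> (complex^2 \<Rightarrow> complex) \<Rightarrow> (complex^2 \<Rightarrow> complex) \<Rightarrow> (complex^2 \<Rightarrow> complex) \<Rightarrow> (fpoint \<times> fpoint) set" where
  "graph n m h l p = {(hpt n (x, u, v), hpt m (x, l x * u, h x * v - p x * u)) | x u v.
     (x, u, v) \<in> hcoord \<and> h x \<noteq> 0 \<and> l x \<noteq> 0}"

text \<open>The formula is independent of the representative: rescaling by \<open>(c, e)\<close> on
  the source becomes rescaling by \<open>(c, c ^ a * e)\<close> on the target, which is what the
  degree condition \<open>m + b = n + a\<close> expresses.\<close>

lemma graph_iff:
  assumes "homog a h" "homog b l" "homog (a + n) p" "m + b = n + a" "(x, u, v) \<in> hcoord"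
  shows "(hpt n (x, u, v), z) \<in> graph n m h l p \<longleftrightarrow>
    h x \<noteq> 0 \<and> l x \<noteq> 0 \<and> z = hpt m (x, l x * u, h x * v - p x * u)"
proof
  assume "(hpt n (x, u, v), z) \<in> graph n m h l p"
  then obtain x' u' v' where *: "hpt n (x, u, v) = hpt n (x', u', v')"
    "z = hpt m (x', l x' * u', h x' * v' - p x' * u')" "h x' \<noteq> 0" "l x' \<noteq> 0"
    by (auto simp: graph_def)
  then obtain c e where ce: "c \<noteq> 0" "e \<noteq> 0" "x' = c *s x" "u' = e * u / c ^ n" "v' = e * v"
    using hpt_eq_iff by blast
  have hs: "h x' = c ^ a * h x" "l x' = c ^ b * l x" "p x' = c ^ a * c ^ n * p x"
    using assms ce(3) by (simp_all add: homog_def power_add)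
  have cc: "c ^ m * c ^ b = c ^ n * c ^ a"
    using assms(4) by (simp flip: power_add)
  have "z = hpt m (x, l x * u, h x * v - p x * u)"
    unfolding *(2)
  proof (rule hpt_eqI[symmetric])
    show "c \<noteq> 0" "c ^ a * e \<noteq> 0" "x' = c *s x" using ce by auto
    show "l x' * u' = c ^ a * e * (l x * u) / c ^ m"
      using ce(1) cc by (simp add: hs ce(4) field_simps)
    show "h x' * v' - p x' * u' = c ^ a * e * (h x * v - p x * u)"
      using ce(1) by (simp add: hs ce(4,5) field_simps)
  qed
  with *(3,4) show "h x \<noteq> 0 \<and> l x \<noteq> 0 \<and> z = hpt m (x, l x * u, h x * v - p x * u)"
    by (simp add: hs)
qed (use assms(5) in \<open>auto simp: graph_def\<close>)

text \<open>Over each \<open>x\<close> the maps act on \<open>(u, v)\<close> by lower triangular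
  matrices with diagonal \<open>(l, h)\<close>, which are multiplied. The scaling laws concern the
  second map, which is applied to the representative produced by the first.\<close>

lemma graph_comp:
  assumes "homog a h'" "homog b l'" "homog (a + m) p'" "k + b = m + a"
  shows "graph n m h l p O graph m k h' l' p' =
    graph n k (\<lambda>x. h x * h' x) (\<lambda>x. l x * l' x) (\<lambda>x. h' x * p x + p' x * l x)"
proof -
  have coord: "(x, l x * u, h x * v - p x * u) \<in> hcoord"
    if "(x, u, v) \<in> hcoord" "h x \<noteq> 0" "l x \<noteq> 0" for x u v
    using that by (auto simp: hcoord_def)
  have eq: "h' x * (h x * v - p x * u) - p' x * (l x * u) =
      h x * h' x * v - (h' x * p x + p' x * l x) * u" for x u v
    by (simp add: algebra_simps)
  show ?thesis
  proof (intro set_eqI iffI)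
    fix t assume "t \<in> graph n m h l p O graph m k h' l' p'"
    then obtain y z x u v where t: "t = (y, z)" "y = hpt n (x, u, v)" "(x, u, v) \<in> hcoord"
      "h x \<noteq> 0" "l x \<noteq> 0" "(hpt m (x, l x * u, h x * v - p x * u), z) \<in> graph m k h' l' p'"
      by (auto simp: graph_def[of n m])
    then have "h' x \<noteq> 0 \<and> l' x \<noteq> 0 \<and>
        z = hpt k (x, l' x * (l x * u), h' x * (h x * v - p x * u) - p' x * (l x * u))"
      using graph_iff[OF assms coord] by blast
    then show "t \<in> graph n k (\<lambda>x. h x * h' x) (\<lambda>x. l x * l' x) (\<lambda>x. h' x * p x + p' x * l x)"
      using t unfolding eq graph_def by (auto simp: ac_simps)
  next
    fix t assume "t \<in> graph n k (\<lambda>x. h x * h' x) (\<lambda>x. l x * l' x) (\<lambda>x. h' x * p x + p' x * l x)"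
    then obtain x u v where t: "t = (hpt n (x, u, v),
        hpt k (x, l x * l' x * u, h x * h' x * v - (h' x * p x + p' x * l x) * u))"
      "(x, u, v) \<in> hcoord" "h x \<noteq> 0" "h' x \<noteq> 0" "l x \<noteq> 0" "l' x \<noteq> 0"
      by (auto simp: graph_def)
    have "(hpt m (x, l x * u, h x * v - p x * u),
        hpt k (x, l x * l' x * u, h x * h' x * v - (h' x * p x + p' x * l x) * u)) \<in> graph m k h' l' p'"
      unfolding graph_iff[OF assms coord[OF t(2,3,5)]] using t eq by (simp add: ac_simps)
    moreover have "(hpt n (x, u, v), hpt m (x, l x * u, h x * v - p x * u)) \<in> graph n m h l p"
      using t unfolding graph_def by blast
    ultimately show "t \<in> graph n m h l p O graph m k h' l' p'"
      using t(1) by blast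
  qed
qed

lemma graph_id: "Id_on (hirzebruch n) = graph n n (\<lambda>x. 1) (\<lambda>x. 1) (\<lambda>x. 0)"
  by (auto simp: graph_def hirzebruch_def Id_on_def)

section \<open>Elementary transformations as fibrewise maps\<close>

lemma elem_secondI:
  assumes "(x, u, v) \<in> hcoord" "(a, b) \<noteq> (0, 0)" "a * (v - peval p x * u) = b * fib q x"
  shows "(hpt (Suc n) (x, u, v), hpt n (x, a * u, b)) \<in> elem_second n q p"
proof -
  have "((x, u, v), a, b) \<in> blowup_coord q (\<lambda>(x, u, v). v - peval p x * u)"
    using assms by (simp add: blowup_coord_def)
  then show ?thesis unfolding elem_second_def by blast
qed

lemma elem_secondE:
  assumes "(y, z) \<in> elem_second n q p"
  obtains x u v a b where "y = hpt (Suc n) (x, u, v)" "z = hpt n (x, a * u, b)"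
     "(x, u, v) \<in> hcoord" "(a, b) \<noteq> (0, 0)" "a * (v - peval p x * u) = b * fib q x"
proof -
  obtain x u v a b where "y = hpt (Suc n) (x, u, v)" "z = hpt n (x, a * u, b)"
    "((x, u, v), a, b) \<in> blowup_coord q (\<lambda>(x, u, v). v - peval p x * u)"
    using assms unfolding elem_second_def by blast
  then show ?thesis by (intro that) (auto simp: blowup_coord_def)
qed

text \<open>Over the fibre \<open>fib q = 0\<close> the transformation is nowhere one-to-one: the centre corresponds to
  a whole curve, and all other points have the same image.\<close>

lemma biregular_elem_second_not_fibre:
  assumes "(y, z) \<in> biregular (elem_second n q p)" and x: "(x, u, v) \<in> hcoord"
    and yz: "y = hpt (Suc n) (x, u, v)" "z = hpt n (x, a * u, b)" "(a, b) \<noteq> (0, 0)"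
      "a * (v - peval p x * u) = b * fib q x"
  shows "fib q x \<noteq> 0"
proof
  assume fib: "fib q x = 0"
  have x0: "x \<noteq> 0" using x by (auto simp: hcoord_def)
  have right: "z' = z" if "(y, z') \<in> elem_second n q p" for z'
    using assms(1) that unfolding biregular_def by blast
  have left: "y' = y" if "(y', z) \<in> elem_second n q p" for y'
    using assms(1) that unfolding biregular_def by blast
  show False
  proof (cases "v = peval p x * u")
    case True
    then have u: "u \<noteq> 0" using x by (auto simp: hcoord_def)
    \<comment> \<open>At the centre every \<open>(a : b)\<close> is admissible;
      \<open>(1 : 0)\<close> and \<open>(0 : 1)\<close> have different images.\<close>
    have "(y, hpt n (x, 1 * u, 0)) \<in> elem_second n q p" "(y, hpt n (x, 0 * u, 1)) \<in> elem_second n q p"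
      unfolding yz(1) using fib True by (intro elem_secondI[OF x]; simp)+
    then have "hpt n (x, 0, 1) = hpt n (x, u, 0)"
      using right[of "hpt n (x, 1 * u, 0)"] right[of "hpt n (x, 0 * u, 1)"] by simp
    then show False using u x0 by (auto elim!: hpt_same_fibreD)
  next
    case False
    then have a: "a = 0" using yz(4) fib by simp
    \<comment> \<open>With \<open>a = 0\<close> the image forgets \<open>(u, v)\<close>. Adding
      \<open>(1, peval p x)\<close> keeps \<open>v - peval p x * u\<close> unchanged, hence nonzero,
      and moves the point to another one of the fibre.\<close>
    have "(hpt (Suc n) (x, u + 1, v + peval p x), hpt n (x, a * (u + 1), b)) \<in> elem_second n q p"
    proof (rule elem_secondI)
      show "(x, u + 1, v + peval p x) \<in> hcoord"
        using x0 False by (auto simp: hcoord_def add_eq_0_iff algebra_simps)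
    qed (use yz(3) a fib in auto)
    then have "hpt (Suc n) (x, u, v) = hpt (Suc n) (x, u + 1, v + peval p x)"
      using left[of "hpt (Suc n) (x, u + 1, v + peval p x)"] by (simp add: a yz(1,2))
    then obtain e where e: "u + 1 = e * u" "v + peval p x = e * v"
      using x0 by (auto elim!: hpt_same_fibreD)
    then have "1 = (e - 1) * u" "peval p x = (e - 1) * v"
      by (simp_all add: algebra_simps)
    then have "peval p x * u = v"
      by (metis mult.assoc mult.commute mult_1)
    with False show False by simp
  qed
qed

text \<open>Off the fibre over \<open>q\<close> the blow-up coordinate is determined as
  \<open>(a : b) = (fib q x : v - peval p x * u)\<close>, and the correspondence is one-to-one
  there.\<close>

lemma biregular_elem_second:
  assumes p: "homog (Suc n) (peval p)"
  shows "biregular (elem_second n q p) = graph (Suc n) n (\<lambda>x. 1) (fib q) (peval p)"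
proof -
  have img: "hpt n (x, a * u, b) = hpt n (x, fib q x * u, v - peval p x * u) \<and> a \<noteq> 0"
    if "fib q x \<noteq> 0" "(a, b) \<noteq> (0, 0)" "a * (v - peval p x * u) = b * fib q x" for x u v a b
  proof
    show a: "a \<noteq> 0" using that by auto
    have "b = a / fib q x * (v - peval p x * u)" using that by (simp add: field_simps)
    then show "hpt n (x, a * u, b) = hpt n (x, fib q x * u, v - peval p x * u)"
      using that a by (intro hpt_eqI[symmetric, of 1 "a / fib q x"]) auto
  qed
  have graph: "(hpt (Suc n) (x, u, v), z) \<in> graph (Suc n) n (\<lambda>x. 1) (fib q) (peval p) \<longleftrightarrow>
    fib q x \<noteq> 0 \<and> z = hpt n (x, fib q x * u, v - peval p x * u)" if "(x, u, v) \<in> hcoord" for x u v z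
    using graph_iff[of 0 "\<lambda>x. 1" 1 "fib q" "Suc n" "peval p" n, OF _ _ _ _ that] p
    by (simp add: homog_def fib_scale)
  show ?thesis
  proof (intro set_eqI iffI)
    fix t assume t: "t \<in> biregular (elem_second n q p)"
    obtain y z where yz: "t = (y, z)" by (cases t)
    from t have "(y, z) \<in> elem_second n q p" by (simp add: yz biregular_def)
    then obtain x u v a b where *: "y = hpt (Suc n) (x, u, v)" "z = hpt n (x, a * u, b)"
      "(x, u, v) \<in> hcoord" "(a, b) \<noteq> (0, 0)" "a * (v - peval p x * u) = b * fib q x"
      by (rule elem_secondE)
    have nz: "fib q x \<noteq> 0"
      using biregular_elem_second_not_fibre[OF t[unfolded yz] *(3,1,2,4,5)] .
    show "t \<in> graph (Suc n) n (\<lambda>x. 1) (fib q) (peval p)"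
      unfolding yz *(1,2) graph[OF *(3)] using img[OF nz *(4,5)] nz by blast
  next
    fix t assume "t \<in> graph (Suc n) n (\<lambda>x. 1) (fib q) (peval p)"
    then obtain x u v where t: "t = (hpt (Suc n) (x, u, v), hpt n (x, fib q x * u, v - peval p x * u))"
      "(x, u, v) \<in> hcoord" "fib q x \<noteq> 0"
      by (auto simp: graph_def)
    have "t \<in> elem_second n q p"
      unfolding t(1) using t(2,3) by (intro elem_secondI) auto
    moreover have "z' = hpt n (x, fib q x * u, v - peval p x * u)"
      if z': "(hpt (Suc n) (x, u, v), z') \<in> elem_second n q p" for z'
    proof -
      obtain x' u' v' a b where *: "hpt (Suc n) (x, u, v) = hpt (Suc n) (x', u', v')"
        "z' = hpt n (x', a * u', b)" "(x', u', v') \<in> hcoord" "(a, b) \<noteq> (0, 0)"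
        "a * (v' - peval p x' * u') = b * fib q x'"
        using z' by (rule elem_secondE)
      obtain c where "c \<noteq> 0" "x' = c *s x" using *(1) hpt_eq_iff by blast
      then have nz: "fib q x' \<noteq> 0" using t(3) by (simp add: fib_scale)
      have "(hpt (Suc n) (x, u, v), z') \<in> graph (Suc n) n (\<lambda>x. 1) (fib q) (peval p)"
        unfolding *(1,2) graph[OF *(3)] using img[OF nz *(4,5)] nz by blast
      then show ?thesis using graph[OF t(2)] by blast
    qed
    moreover have "y' = hpt (Suc n) (x, u, v)"
      if y': "(y', hpt n (x, fib q x * u, v - peval p x * u)) \<in> elem_second n q p" for y'
    proof -
      obtain x' u' v' a b where *: "y' = hpt (Suc n) (x', u', v')"
        "hpt n (x, fib q x * u, v - peval p x * u) = hpt n (x', a * u', b)"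
        "(x', u', v') \<in> hcoord" "(a, b) \<noteq> (0, 0)"
        "a * (v' - peval p x' * u') = b * fib q x'"
        using y' by (rule elem_secondE)
      obtain c e where ce: "c \<noteq> 0" "e \<noteq> 0" "x' = c *s x"
        "a * u' = e * (fib q x * u) / c ^ n" "b = e * (v - peval p x * u)"
        using *(2) hpt_eq_iff by blast
      have "fib q x' \<noteq> 0" using t(3) ce by (simp add: fib_scale)
      then have a: "a \<noteq> 0" using * by auto
      \<comment> \<open>The factor that rescales \<open>(u, v)\<close> to \<open>(u', v')\<close>,
        found by solving \<open>u' = k * u / c ^ Suc n\<close>.\<close>
      define k where "k = e * fib q x * c / a"
      have k: "k \<noteq> 0" using a ce t(3) by (simp add: k_def)
      have u': "u' = k * u / c ^ Suc n"
        using ce(1,4) a by (simp add: k_def field_simps)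
      have px: "peval p x' * u' = k * (peval p x * u)"
        using p ce(1) by (simp add: ce(3) u' homog_def)
      have "v' - peval p x' * u' = k * (v - peval p x * u)"
        using *(5) a by (simp add: ce(3,5) fib_scale k_def field_simps)
      then have "v' = k * v" unfolding px by (simp add: algebra_simps)
      then show ?thesis
        unfolding *(1) using hpt_eqI[OF ce(1) k ce(3) u'] by simp
    qed
    ultimately show "t \<in> biregular (elem_second n q p)"
      unfolding biregular_def t(1) by blast
  qed
qed

lemma biregular_converse: "biregular (R\<inverse>) = (biregular R)\<inverse>"
  by (auto simp: biregular_def)

text \<open>The converse of the second type with centre on \<open>v = 0\<close>; on the fibre,
  multiplying \<open>v\<close> by \<open>fib q x\<close> inverts multiplying \<open>u\<close> by it,
  up to a common scalar.\<close>

lemma biregular_elem_first: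
  "biregular (elem_first n q) = graph n (Suc n) (fib q) (\<lambda>x. 1) (\<lambda>x. 0)"
proof -
  have zero: "peval (0 :: 2 cpoly) = (\<lambda>x. 0)" by auto
  have "elem_first n q = (elem_second n q 0)\<inverse>"
    using elem_first_converse[of n q] by (metis converse_converse)
  then have "biregular (elem_first n q) = (graph (Suc n) n (\<lambda>x. 1) (fib q) (\<lambda>x. 0))\<inverse>"
    using biregular_elem_second[of n 0 q] zero by (simp add: biregular_converse homog_def)
  also have "\<dots> = graph n (Suc n) (fib q) (\<lambda>x. 1) (\<lambda>x. 0)"
  proof (intro set_eqI iffI)
    fix t assume "t \<in> (graph (Suc n) n (\<lambda>x. 1) (fib q) (\<lambda>x. 0))\<inverse>"
    then obtain x u v where t: "t = (hpt n (x, fib q x * u, v), hpt (Suc n) (x, u, v))"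
      "(x, u, v) \<in> hcoord" "fib q x \<noteq> 0"
      by (auto simp: graph_def)
    have "hpt (Suc n) (x, u, v) = hpt (Suc n) (x, fib q x * u, fib q x * v)"
      using t by (intro hpt_eqI[of 1 "fib q x"]) auto
    moreover have "(x, fib q x * u, v) \<in> hcoord" using t by (auto simp: hcoord_def)
    ultimately show "t \<in> graph n (Suc n) (fib q) (\<lambda>x. 1) (\<lambda>x. 0)"
      unfolding graph_def using t by auto
  next
    fix t assume "t \<in> graph n (Suc n) (fib q) (\<lambda>x. 1) (\<lambda>x. 0)"
    then obtain x u v where t: "t = (hpt n (x, u, v), hpt (Suc n) (x, u, fib q x * v))"
      "(x, u, v) \<in> hcoord" "fib q x \<noteq> 0"
      by (auto simp: graph_def)
    have "hpt n (x, u, v) = hpt n (x, fib q x * u, fib q x * v)"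
      using t by (intro hpt_eqI[of 1 "fib q x"]) auto
    moreover have "(x, u, fib q x * v) \<in> hcoord" using t by (auto simp: hcoord_def)
    ultimately show "t \<in> (graph (Suc n) n (\<lambda>x. 1) (fib q) (\<lambda>x. 0))\<inverse>"
      unfolding graph_def using t by auto
  qed
  finally show ?thesis .
qed

section \<open>Composites of the elementary transformations\<close>

definition fibs :: "(complex^2) list \<Rightarrow> complex^2 \<Rightarrow> complex" where
  "fibs qs x = (\<Prod>q\<leftarrow>qs. fib q x)"

text \<open>The form \<open>p\<close> of the composite of the second-type steps, by the rule of
  \<open>graph_comp\<close>: a Horner scheme in \<open>fib r\<close>, each later centre being
  multiplied by the equations of the fibres divided out before.\<close>

fun centres_form :: "complex^2 \<Rightarrow> 2 cpoly list \<Rightarrow> complex^2 \<Rightarrow> complex" where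
  "centres_form r [] x = 0"
| "centres_form r (p # ps) x = peval p x + centres_form r ps x * fib r x"

lemma form_fibs: "form (length qs) (fibs qs)"
proof (induction qs)
  case (Cons q qs)
  then show ?case
    using form_mult[OF form_fib Cons.IH, of q] by (simp add: fibs_def)
qed (use form_const[of 1] in \<open>simp add: fibs_def\<close>)

lemma form_centres_form:
  assumes "\<forall>j<length ps. homogeneous (length ps + 1 - j) (ps ! j)"
  shows "form (length ps + 1) (centres_form r ps)"
  using assms
proof (induction ps)
  case (Cons p ps)
  have "homogeneous (length ps + 1 - j) (ps ! j)" if "j < length ps" for j
    using Cons.prems[rule_format, of "Suc j"] that by simp
  then have "form (length ps + 1) (centres_form r ps)" using Cons.IH by blast
  from form_mult[OF this form_fib, of r] have "form (length (p # ps) + 1) (\<lambda>x. centres_form r ps x * fib r x)"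
    by simp
  moreover have "form (length (p # ps) + 1) (peval p)"
    using Cons.prems[rule_format, of 0] by (auto simp: form_def)
  ultimately show ?case using form_add by fastforce
next
  case Nil
  have "centres_form r [] = (\<lambda>x. 0)" by auto
  then show ?case by (simp add: form_0)
qed

lemma first_steps_eq:
  "first_steps n qs = graph n (n + length qs) (fibs qs) (\<lambda>x. 1) (\<lambda>x. 0)"
proof (induction qs arbitrary: n)
  case Nil
  then show ?case by (simp add: graph_id fibs_def)
next
  case (Cons q qs)
  have "graph n (Suc n) (fib q) (\<lambda>x. 1) (\<lambda>x. 0) O graph (Suc n) (Suc n + length qs) (fibs qs) (\<lambda>x. 1) (\<lambda>x. 0) =
      graph n (Suc n + length qs) (\<lambda>x. fib q x * fibs qs x) (\<lambda>x. 1 * 1) (\<lambda>x. fibs qs x * 0 + 0 * 1)"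
    by (rule graph_comp[of "length qs" _ 0])
      (use form_imp_homog[OF form_fibs] in \<open>auto simp: homog_def\<close>)
  moreover have "fibs (q # qs) = (\<lambda>x. fib q x * fibs qs x)"
    by (simp add: fibs_def fun_eq_iff)
  ultimately show ?case
    by (simp add: Cons biregular_elem_first)
qed

lemma second_steps_eq:
  assumes "\<forall>j<length ps. homogeneous (length ps + 1 - j) (ps ! j)"
  shows "second_steps r ps =
    graph (Suc (length ps)) 1 (\<lambda>x. 1) (\<lambda>x. fib r x ^ length ps) (centres_form r ps)"
  using assms
proof (induction ps)
  case Nil
  then show ?case by (simp add: graph_id)
next
  case (Cons p ps)
  have ps: "\<forall>j<length ps. homogeneous (length ps + 1 - j) (ps ! j)"
  proof (intro allI impI)
    fix j assume "j < length ps"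
    then show "homogeneous (length ps + 1 - j) (ps ! j)"
      using Cons.prems[rule_format, of "Suc j"] by simp
  qed
  have "homogeneous (Suc (Suc (length ps))) p"
    using Cons.prems[rule_format, of 0] by simp
  then have p: "homog (Suc (Suc (length ps))) (peval p)"
    by (intro form_imp_homog) (auto simp: form_def)
  have "graph (Suc (Suc (length ps))) (Suc (length ps)) (\<lambda>x. 1) (fib r) (peval p) O
      graph (Suc (length ps)) 1 (\<lambda>x. 1) (\<lambda>x. fib r x ^ length ps) (centres_form r ps) =
    graph (Suc (Suc (length ps))) 1 (\<lambda>x. 1 * 1) (\<lambda>x. fib r x * fib r x ^ length ps)
      (\<lambda>x. 1 * peval p x + centres_form r ps x * fib r x)"
    by (rule graph_comp[of 0 _ "length ps"])
      (use form_imp_homog[OF form_centres_form[OF ps]] in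
        \<open>simp_all add: homog_def fib_scale power_mult_distrib\<close>)
  moreover have "centres_form r (p # ps) = (\<lambda>x. 1 * peval p x + centres_form r ps x * fib r x)"
    by auto
  ultimately show ?case
    by (simp add: Cons.IH[OF ps] biregular_elem_second[OF p])
qed

section \<open>Blow-up and blow-down of the plane\<close>

lemma invertible_matrix_vector_inject:
  fixes A :: "complex^3^3"
  assumes "invertible A" "A *v y = A *v z"
  shows "y = z"
  using assms by (metis invertible_def matrix_vector_mul_assoc matrix_vector_mul_lid)

text \<open>All points with \<open>u = 0\<close> lie over the centre, so none of them is in a
  one-to-one position; for the others \<open>u\<close> is normalised to 1 by absorbing it into
  \<open>x\<close>.\<close>

lemma biregular_blowup_plane:
  assumes A: "invertible A"
  shows "biregular (blowup_plane A) = {(pt y, hpt 1 (x, 1, w)) | y x w. x \<noteq> 0 \<and> A *v y = lift x w}"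
proof -
  have I: "(pt y, hpt 1 (x, u, w)) \<in> blowup_plane A"
    if "(x, u, w) \<in> hcoord" "A *v y = lift (u *s x) w" for y x u w
    using that unfolding blowup_plane_def lift_def vector_smult_component by blast
  have E: "\<exists>y x u w. s = pt y \<and> t = hpt 1 (x, u, w) \<and>
      (x, u, w) \<in> hcoord \<and> A *v y = lift (u *s x) w" if "(s, t) \<in> blowup_plane A" for s t
    using that unfolding blowup_plane_def lift_def vector_smult_component by blast
  have norm: "hpt 1 (x, u, w) = hpt 1 (u *s x, 1, w)" if "u \<noteq> 0" for x u w
    using that by (intro hpt_eqI[of u 1]) auto
  show ?thesis
  proof (intro set_eqI iffI)
    fix t assume t: "t \<in> biregular (blowup_plane A)"
    then have "t \<in> blowup_plane A" by (auto simp: biregular_def)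
    then obtain y x u w where *: "t = (pt y, hpt 1 (x, u, w))" "(x, u, w) \<in> hcoord"
      "A *v y = lift (u *s x) w"
      using E by (metis surj_pair)
    have "u \<noteq> 0"
    proof
      assume u: "u = 0"
      have "hpt 1 (x', 0, w) = hpt 1 (x, u, w)" if "x' \<noteq> 0" for x'
      proof -
        have "(pt y, hpt 1 (x', 0, w)) \<in> blowup_plane A"
          using * u that by (intro I) (auto simp: hcoord_def)
        with t *(1) show ?thesis unfolding biregular_def by blast
      qed
      from this[of "vector [1, 0]"] this[of "vector [0, 1]"]
      have "hpt 1 (vector [1, 0], 0, w) = hpt 1 (vector [0, 1], 0, w)"
        by (simp add: vec_eq_iff forall_2)
      then show False
        unfolding hpt_eq_iff by (auto simp: vec_eq_iff forall_2)
    qed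
    then have "u *s x \<noteq> 0" "t = (pt y, hpt 1 (u *s x, 1, w))"
      using *(2) norm[of u x w] unfolding *(1) by (auto simp: hcoord_def)
    with *(3) show "t \<in> {(pt y, hpt 1 (x, 1, w)) | y x w. x \<noteq> 0 \<and> A *v y = lift x w}"
      by blast
  next
    fix t assume "t \<in> {(pt y, hpt 1 (x, 1, w)) | y x w. x \<noteq> 0 \<and> A *v y = lift x w}"
    then obtain y x w where t: "t = (pt y, hpt 1 (x, 1, w))" "x \<noteq> 0" "A *v y = lift x w"
      by blast
    have "t \<in> blowup_plane A"
      unfolding t(1) using t(2,3) by (intro I) (auto simp: hcoord_def)
    moreover have "z = hpt 1 (x, 1, w)" if z: "(pt y, z) \<in> blowup_plane A" for z
    proof -
      obtain y' x' u' w' where *: "pt y = pt y'" "z = hpt 1 (x', u', w')"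
        "A *v y' = lift (u' *s x') w'"
        using E[OF z] by blast
      obtain c where c: "c \<noteq> 0" "y' = c *s y" using *(1) pt_eq_iff by blast
      then have "lift (u' *s x') w' = lift (c *s x) (c * w)"
        using *(3) t(3) by (simp add: vector_scalar_commute scale_lift)
      then have eq: "u' *s x' = c *s x" "w' = c * w"
        by (metis base_lift, metis lift_nth(3))
      then have u': "u' \<noteq> 0" using c t(2) by auto
      have "hpt 1 (x, 1, w) = hpt 1 (c *s x, 1, c * w)"
        using c by (intro hpt_eqI[of c c]) auto
      then show ?thesis using norm[OF u'] eq *(2) by simp
    qed
    moreover have "s = pt y" if s: "(s, hpt 1 (x, 1, w)) \<in> blowup_plane A" for s
    proof -
      obtain y' x' u' w' where *: "s = pt y'" "hpt 1 (x, 1, w) = hpt 1 (x', u', w')"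
        "A *v y' = lift (u' *s x') w'"
        using E[OF s] by blast
      obtain c e where ce: "c \<noteq> 0" "e \<noteq> 0" "x' = c *s x" "u' = e / c" "w' = e * w"
        using *(2) hpt_eq_iff by auto
      have "A *v y' = A *v (e *s y)"
        using ce *(3) t(3) by (simp add: vector_scalar_commute scale_lift)
      then have "y' = e *s y" by (rule invertible_matrix_vector_inject[OF A])
      then show ?thesis using *(1) ce(2) pt_eq_iff by metis
    qed
    ultimately show "t \<in> biregular (blowup_plane A)"
      unfolding biregular_def t(1) by blast
  qed
qed

lemma blowup_graph:
  assumes "invertible A" "homog a h" "homog b l" "homog (a + 1) p" "m + b = 1 + a"
  shows "biregular (blowup_plane A) O graph 1 m h l p =
    {(pt y, hpt m (x, l x, h x * w - p x)) | y x w. x \<noteq> 0 \<and> h x \<noteq> 0 \<and> l x \<noteq> 0 \<and> A *v y = lift x w}"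
proof -
  have "(hpt 1 (x, 1, w), z) \<in> graph 1 m h l p \<longleftrightarrow>
      h x \<noteq> 0 \<and> l x \<noteq> 0 \<and> z = hpt m (x, l x, h x * w - p x)" if "x \<noteq> 0" for x w z
    using graph_iff[OF assms(2-5), of x 1 w z] that by (simp add: hcoord_def)
  then show ?thesis
    unfolding biregular_blowup_plane[OF assms(1)] relcomp_unfold by blast
qed

text \<open>The middle steps end at \<open>(x, l x, h x * w - p x)\<close> on \<open>F_1\<close>,
  and the blow-down multiplies the base point by the second coordinate.\<close>

lemma cremona_graph:
  assumes "invertible A" "invertible B" "homog a h" "homog a l" "homog (a + 1) p"
  shows "biregular (blowup_plane A) O graph 1 1 h l p O (biregular (blowup_plane B))\<inverse> =
    {(pt y, pt z) | y z x w. x \<noteq> 0 \<and> h x \<noteq> 0 \<and> l x \<noteq> 0 \<and> A *v y = lift x w \<and>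
      B *v z = lift (l x *s x) (h x * w - p x)}"
proof -
  have "biregular (blowup_plane A) O graph 1 1 h l p O (biregular (blowup_plane B))\<inverse> =
      (biregular (blowup_plane A) O graph 1 1 h l p) O (biregular (blowup_plane B))\<inverse>"
    by (simp add: O_assoc)
  also have "\<dots> = {(pt y, pt z) | y z x w. x \<noteq> 0 \<and> h x \<noteq> 0 \<and> l x \<noteq> 0 \<and> A *v y = lift x w \<and>
      B *v z = lift (l x *s x) (h x * w - p x)}" (is "?L = ?R")
  proof (intro set_eqI iffI)
    fix t assume "t \<in> ?L"
    then obtain y x w x' w' z where *: "t = (pt y, pt z)" "x \<noteq> 0" "h x \<noteq> 0" "l x \<noteq> 0"
      "A *v y = lift x w" "hpt 1 (x, l x, h x * w - p x) = hpt 1 (x', 1, w')" "B *v z = lift x' w'"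
      unfolding blowup_graph[OF assms(1,3-5) refl] biregular_blowup_plane[OF assms(2)] by blast
    obtain c e where ce: "c \<noteq> 0" "e \<noteq> 0" "x' = c *s x" "1 = e * l x / c" "w' = e * (h x * w - p x)"
      using *(6) hpt_eq_iff by auto
    then have "c = e * l x" by (simp add: field_simps)
    then have "x' = e *s (l x *s x)" using ce(3) by simp
    then have "B *v z = e *s lift (l x *s x) (h x * w - p x)"
      using *(7) ce(5) by (simp add: scale_lift)
    then have "B *v ((1 / e) *s z) = lift (l x *s x) (h x * w - p x)"
      using ce(2) by (simp add: vector_scalar_commute)
    moreover have "pt z = pt ((1 / e) *s z)"
      using ce(2) pt_eq_iff by (metis divide_eq_0_iff one_neq_zero)
    ultimately show "t \<in> ?R" using * by auto
  next
    fix t assume "t \<in> ?R"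
    then obtain y z x w where *: "t = (pt y, pt z)" "x \<noteq> 0" "h x \<noteq> 0" "l x \<noteq> 0"
      "A *v y = lift x w" "B *v z = lift (l x *s x) (h x * w - p x)"
      by blast
    have "hpt 1 (x, l x, h x * w - p x) = hpt 1 (l x *s x, 1, h x * w - p x)"
      using *(4) by (intro hpt_eqI[of "l x" 1]) auto
    moreover have "l x *s x \<noteq> 0" using * by auto
    ultimately show "t \<in> ?L"
      unfolding blowup_graph[OF assms(1,3-5) refl] biregular_blowup_plane[OF assms(2)]
      using * by blast
  qed
  finally show ?thesis .
qed

section \<open>The degree of the proper transform\<close>

lemma reduced_equation_pt_iff:
  assumes "reduced_equation d F C" "v \<noteq> 0"
  shows "pt v \<in> C \<longleftrightarrow> peval F v = 0"
proof
  assume "pt v \<in> C"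
  then obtain w where w: "pt w = pt v" "peval F w = 0"
    using assms(1) by (auto simp: reduced_equation_def)
  then obtain c where "v = c *s w" using pt_eq_iff by blast
  moreover have "form d (peval F)"
    using assms(1) by (auto simp: form_def reduced_equation_def)
  ultimately show "peval F v = 0" using w(2) by (simp add: form_scale)
qed (use assms in \<open>auto simp: reduced_equation_def\<close>)

text \<open>A factorisation in the new coordinates is carried back by \<open>A\<close> to polynomial
  functions and, by injectivity of evaluation, to formal polynomials; there \<open>X'\<close> is a
  unit and thus without zeros.\<close>

lemma squarefree_imp_reduced:
  fixes F :: "3 cpoly" and A A' :: "complex^3^3"
  assumes F: "squarefree F" and A: "A ** A' = mat 1" "A' ** A = mat 1"
  shows "reduced (\<lambda>z. peval F (A' *v z))"
  unfolding reduced_def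
proof (intro allI impI)
  fix X K :: "complex^3 \<Rightarrow> complex" and z
  assume X: "polyfun X" and K: "polyfun K" and eq: "\<forall>z. peval F (A' *v z) = X z ^ 2 * K z"
  obtain X' where X': "\<And>y. peval X' y = X (A *v y)"
    using polyfun_linear[OF X, of A] by (auto simp: polyfun_def fun_eq_iff)
  obtain K' where K': "\<And>y. peval K' y = K (A *v y)"
    using polyfun_linear[OF K, of A] by (auto simp: polyfun_def fun_eq_iff)
  have "F = X' ^ 2 * K'"
  proof (rule peval_inject)
    fix y
    have "y = A' *v (A *v y)" using A by (simp add: matrix_vector_mul_assoc)
    then show "peval F y = peval (X' ^ 2 * K') y"
      using eq by (metis X' K' peval_mult power2_eq_square)
  qed
  then have "X' dvd 1" using F by (intro squarefreeD[OF F]) simp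
  then obtain Y where "1 = X' * Y" by (rule dvdE)
  then have "peval X' y \<noteq> 0" for y
    using peval_mult[of X' Y y] by (metis mult_zero_left peval_1 one_neq_zero)
  moreover have "z = A *v (A' *v z)" using A by (simp add: matrix_vector_mul_assoc)
  ultimately show "X z \<noteq> 0" using X' by metis
qed

lemma lift_nonzero: "x \<noteq> 0 \<Longrightarrow> lift x w \<noteq> 0"
  by (auto simp: vec_eq_iff forall_2 forall_3)

lemma fib_eq_0D:
  assumes "q \<noteq> 0" "x \<noteq> 0" "fib q x = 0"
  obtains c where "c \<noteq> 0" "x = c *s q"
proof -
  have f: "q $ 1 * x $ 2 = q $ 2 * x $ 1" using assms(3) by (simp add: fib_def)
  obtain c where c: "x = c *s q"
  proof (cases "q $ 1 = 0")
    case True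
    then have "q $ 2 \<noteq> 0" using assms(1) by (auto simp: vec_eq_iff forall_2)
    with f True have "x = (x $ 2 / q $ 2) *s q" by (simp add: vec_eq_iff forall_2)
    then show ?thesis using that by blast
  next
    case False
    with f have "x = (x $ 1 / q $ 1) *s q"
      by (simp add: vec_eq_iff forall_2 field_simps)
    then show ?thesis using that by blast
  qed
  with assms(2) have "c \<noteq> 0" by auto
  with c show ?thesis using that by blast
qed

lemma pencil_line_scale:
  assumes "c \<noteq> 0"
  shows "pencil_line A (c *s q) = pencil_line A q"
proof -
  have "fib (c *s q) x = c * fib q x" for x by (simp add: fib_def algebra_simps)
  then show ?thesis using assms by (simp add: pencil_line_def)
qed

context transformation
begin

text \<open>The equation is \<open>g\<close> read in the coordinates \<open>B\<close> of the final
  plane: \<open>square_factor_const\<close> makes it squarefree, and \<open>vanishing\<close>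
  identifies its zero set with the closure.\<close>

lemma plane_curve_of_degree_closure:
  fixes B B' :: "complex^3^3"
  assumes red: "reduced f" and B: "B ** B' = mat 1" "B' ** B = mat 1"
    and S: "\<And>z. pt z \<in> S \<longleftrightarrow> base (B *v z) \<noteq> 0 \<and> h (base (B *v z)) \<noteq> 0 \<and>
      l (base (B *v z)) \<noteq> 0 \<and> g (B *v z) = 0"
  shows "plane_curve_of_degree (zariski_closure S) (d * (N + 1))"
proof -
  have BB': "B *v (B' *v z) = z" "B' *v (B *v z) = z" for z
    using B by (simp_all add: matrix_vector_mul_assoc)
  obtain G where G: "homogeneous (d * (N + 1)) G" "\<And>z. peval G z = g (B *v z)"
    using form_linear[OF form_g, of B] by (auto simp: form_def fun_eq_iff)
  have "squarefree G"
  proof (rule squarefreeI)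
    fix X assume "X ^ 2 dvd G"
    then obtain K where K: "G = X ^ 2 * K" by blast
    have "g z = peval X (B' *v z) ^ 2 * peval K (B' *v z)" for z
      using G(2)[of "B' *v z"] by (simp add: BB' K peval_mult power2_eq_square)
    moreover have "polyfun (\<lambda>z. peval X (B' *v z))" "polyfun (\<lambda>z. peval K (B' *v z))"
      by (rule polyfun_linear, force simp: polyfun_def)+
    ultimately obtain c where c: "c \<noteq> 0" "\<And>z. peval X (B' *v z) = c"
      using square_factor_const[OF red] by blast
    have "peval X z = c" for z using c(2)[of "B *v z"] by (simp add: BB')
    then have "1 = X * Poly_Mapping.single 0 (1 / c)"
      using c(1) by (intro peval_inject) (simp add: peval_mult peval_single)
    then show "X dvd 1" by (rule dvdI)
  qed
  moreover have "zariski_closure S = {pt v | v. v \<noteq> 0 \<and> peval G v = 0}"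
  proof -
    have "(\<forall>e F. homogeneous e F \<and> (\<forall>w. pt w \<in> S \<longrightarrow> peval F w = 0) \<longrightarrow> peval F v = 0) \<longleftrightarrow>
        peval G v = 0" if "v \<noteq> 0" for v
    proof
      assume "\<forall>e F. homogeneous e F \<and> (\<forall>w. pt w \<in> S \<longrightarrow> peval F w = 0) \<longrightarrow> peval F v = 0"
      then show "peval G v = 0" using G S by metis
    next
      assume v: "peval G v = 0"
      show "\<forall>e F. homogeneous e F \<and> (\<forall>w. pt w \<in> S \<longrightarrow> peval F w = 0) \<longrightarrow> peval F v = 0"
      proof (intro allI impI)
        fix e F assume F: "homogeneous e F \<and> (\<forall>w. pt w \<in> S \<longrightarrow> peval F w = 0)"
        have "form e (\<lambda>z. peval F (B' *v z))"
          using F by (intro form_linear) (auto simp: form_def)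
        moreover have "peval F (B' *v z) = 0"
          if "g z = 0" "base z \<noteq> 0" "h (base z) \<noteq> 0" "l (base z) \<noteq> 0" for z
          using F S[of "B' *v z"] that by (simp add: BB')
        moreover have "B *v v \<noteq> 0" using that BB'(2)[of v] by auto
        moreover have "g (B *v v) = 0" using v G(2) by simp
        ultimately have "peval F (B' *v (B *v v)) = 0" by (rule vanishing)
        then show "peval F v = 0" by (simp add: BB')
      qed
    qed
    then show ?thesis unfolding zariski_closure_def by blast
  qed
  ultimately have "reduced_equation (d * (N + 1)) G (zariski_closure S)"
    using G(1) d by (simp add: reduced_equation_def)
  then show ?thesis unfolding plane_curve_of_degree_def by blast
qed

text \<open>One inclusion is \<open>g_push\<close>. For the other, \<open>pull\<close> supplies the
  preimage and \<open>push_pull\<close> shows that it is mapped back to the given point.\<close>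

lemma pt_in_image_iff:
  fixes A A' B B' :: "complex^3^3"
  assumes F: "reduced_equation d F C" and f_eq: "\<And>z. f z = peval F (A' *v z)"
    and A: "A ** A' = mat 1" "A' ** A = mat 1" and B: "B' ** B = mat 1"
  shows "pt z \<in> {(pt y, pt z) | y z x w. x \<noteq> 0 \<and> h x \<noteq> 0 \<and> l x \<noteq> 0 \<and> A *v y = lift x w \<and>
      B *v z = lift (l x *s x) (h x * w - p x)} `` C \<longleftrightarrow>
    base (B *v z) \<noteq> 0 \<and> h (base (B *v z)) \<noteq> 0 \<and> l (base (B *v z)) \<noteq> 0 \<and> g (B *v z) = 0"
    (is "pt z \<in> ?T `` C \<longleftrightarrow> ?good")
proof
  have AA': "A *v (A' *v z) = z" "A' *v (A *v z) = z" for z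
    using A by (simp_all add: matrix_vector_mul_assoc)
  {
    assume "pt z \<in> ?T `` C"
    then obtain y z' x w where *: "pt z = pt z'" "pt y \<in> C" "x \<noteq> 0" "h x \<noteq> 0" "l x \<noteq> 0"
      "A *v y = lift x w" "B *v z' = lift (l x *s x) (h x * w - p x)"
      by blast
    obtain c where c: "c \<noteq> 0" "z = c *s z'" using *(1) pt_eq_iff by metis
    have Bz: "B *v z = c *s lift (l x *s x) (h x * w - p x)"
      by (simp add: c(2) vector_scalar_commute *(7))
    then have base: "base (B *v z) = (c * l x) *s x" by (simp add: scale_lift)
    have "y \<noteq> 0" using *(6) lift_nonzero[OF *(3)] by auto
    then have "f (lift x w) = 0"
      using *(2) reduced_equation_pt_iff[OF F] AA'(2) *(6) f_eq by metis
    then have "g (B *v z) = 0"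
      unfolding Bz form_scale[OF form_g] g_push by simp
    then show ?good
      using * c(1) by (simp add: base form_scale[OF h] form_scale[OF l])
  }
  {
    assume good: ?good
    define x where "x = base (pull (B *v z))"
    define w where "w = pull (B *v z) $ 3"
    define y where "y = A' *v lift x w"
    \<comment> \<open>The scalar of \<open>push_pull\<close>: the image of \<open>y\<close> is
      represented by \<open>k *s z\<close>, the same projective point as \<open>z\<close>.\<close>
    define k where "k = h (base (B *v z)) ^ Suc N * l (base (B *v z))"
    have x: "x = h (base (B *v z)) *s base (B *v z)" by (simp add: x_def pull_def)
    then have nz: "x \<noteq> 0" "h x \<noteq> 0" "l x \<noteq> 0"
      using good by (simp_all add: form_scale[OF h] form_scale[OF l])
    have "B *v (k *s z) = lift (l x *s x) (h x * w - p x)"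
      using push_pull[of "B *v z"] by (simp add: x_def w_def k_def vector_scalar_commute del: power_Suc)
    moreover have Ay: "A *v y = lift x w" by (simp add: y_def AA')
    ultimately have T: "(pt y, pt (k *s z)) \<in> ?T" using nz by blast
    have "y \<noteq> 0" using Ay lift_nonzero[OF nz(1)] by auto
    moreover have "f (lift x w) = 0" using good by (simp add: g_def x_def w_def)
    ultimately have y: "pt y \<in> C"
      using reduced_equation_pt_iff[OF F] f_eq by (simp add: y_def)
    have "k \<noteq> 0" using good by (simp add: k_def)
    then have "pt z = pt (k *s z)" unfolding pt_eq_iff by blast
    with T y show "pt z \<in> ?T `` C" by (simp only: ImageI)
  }
qed

end

lemma fibs_replicate:
  assumes "length qs = length ns"
  shows "length (concat (map2 replicate ns qs)) = sum_list ns"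
    "set (concat (map2 replicate ns qs)) \<subseteq> set qs"
proof -
  show "length (concat (map2 replicate ns qs)) = sum_list ns"
    using assms by (induction qs ns rule: list_induct2) simp_all
  show "set (concat (map2 replicate ns qs)) \<subseteq> set qs"
    by (auto dest: set_zip_rightD)
qed

lemma centres_form_at: "fib r x = 0 \<Longrightarrow> ps \<noteq> [] \<Longrightarrow> centres_form r ps x = peval (hd ps) x"
  by (cases ps) simp_all

theorem proposition5p6:
  fixes C :: "point2 set" and d :: nat and ns :: "nat list" and T :: "(point2 \<times> point2) set"
  assumes "plane_curve_of_degree C d"
    and "\<forall>n\<in>set ns. 1 \<le> n"
    and "cremona_T C ns T"
  shows "plane_curve_of_degree (proper_transform T C) (d * (sum_list ns + 1))"
proof -
  obtain F where F: "reduced_equation d F C"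
    using assms(1) by (auto simp: plane_curve_of_degree_def)
  then have F': "d > 0" "homogeneous d F" "squarefree F" by (simp_all add: reduced_equation_def)
  define N where "N = sum_list ns"
  obtain Op A B qs r ps where A: "invertible A" and B: "invertible B"
    and Op: "\<exists>y. Op = pt y \<and> A *v y = axis 3 1" "Op \<notin> C"
    and qs: "length qs = length ns" "0 \<notin> set qs" "r \<noteq> 0"
      "distinct (pencil_line A r # map (pencil_line A) qs)"
    and ps: "length ps = N" "\<forall>j<length ps. homogeneous (length ps + 1 - j) (ps ! j)"
    and T: "T = (biregular (blowup_plane A) O first_steps 1 (concat (map2 replicate ns qs))) O
        second_steps r ps O (biregular (blowup_plane B))\<inverse>"
    and cen: "ps \<noteq> [] \<Longrightarrow> second_centre (length ps) r (hd ps) \<notin>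
        (biregular (blowup_plane A) O first_steps 1 (concat (map2 replicate ns qs))) `` C"
    using assms(3) unfolding cremona_T_def Let_def N_def by blast
  define rs where "rs = concat (map2 replicate ns qs)"
  have rs: "length rs = N" "set rs \<subseteq> set qs"
    using fibs_replicate[OF qs(1)] by (simp_all add: rs_def N_def)
  define h where "h = fibs rs"
  define l where "l x = fib r x ^ N" for x
  define p where "p = centres_form r ps"
  have h: "form N h" using form_fibs[of rs] rs by (simp add: h_def)
  have l: "form N l" using form_power[OF form_fib, of N r] by (simp add: l_def[abs_def])
  have p: "form (Suc N) p" using form_centres_form[OF ps(2), of r] ps(1) by (simp add: p_def)
  obtain A' where A': "A ** A' = mat 1" "A' ** A = mat 1"
    using A by (auto simp: invertible_def)
  obtain B' where B': "B ** B' = mat 1" "B' ** B = mat 1"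
    using B by (auto simp: invertible_def)
  have AA': "A *v (A' *v z) = z" "A' *v (A *v z) = z" for z
    using A' by (simp_all add: matrix_vector_mul_assoc)
  \<comment> \<open>The equation of \<open>C\<close> in the frame \<open>A\<close>, where the centre
    is \<open>(0 : 0 : 1)\<close>.\<close>
  define f where "f z = peval F (A' *v z)" for z
  have f: "form d f" unfolding f_def
    using F'(2) by (intro form_linear) (auto simp: form_def)
  have first: "first_steps 1 rs = graph 1 (Suc N) h (\<lambda>x. 1) (\<lambda>x. 0)"
    by (simp add: first_steps_eq h_def rs)
  have fib_rr: "fib r r = 0" by (simp add: fib_def)
  \<comment> \<open>\<open>P\<close> differs from every \<open>Q_i\<close>, so \<open>r\<close> is
    not proportional to any of their base points and no factor of \<open>h\<close> vanishes at
    it.\<close>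
  have hr: "h r \<noteq> 0"
  proof
    assume "h r = 0"
    then obtain q where q: "q \<in> set qs" "fib q r = 0"
      using rs(2) by (auto simp: h_def fibs_def prod_list_zero_iff)
    then have "q \<noteq> 0" using qs(2) by auto
    then obtain c where "c \<noteq> 0" "r = c *s q"
      using q(2) qs(3) fib_eq_0D by blast
    then have "pencil_line A r = pencil_line A q" by (simp add: pencil_line_scale)
    with qs(4) q(1) show False by auto
  qed
  have lnz: "\<exists>x. l x \<noteq> 0"
  proof (cases "r $ 1 = 0")
    case True
    then have "r $ 2 \<noteq> 0" using qs(3) by (auto simp: vec_eq_iff forall_2)
    then have "l (vector [1, 0]) \<noteq> 0" by (simp add: l_def fib_def)
    then show ?thesis by blast
  next
    case False
    then have "l (vector [0, 1]) \<noteq> 0" by (simp add: l_def fib_def)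
    then show ?thesis by blast
  qed
  have f_centre: "f (lift 0 1) \<noteq> 0"
  proof
    assume 0: "f (lift 0 1) = 0"
    obtain y where y: "Op = pt y" "A *v y = axis 3 1" using Op(1) by blast
    have ax: "axis 3 1 = lift 0 1" by (simp add: vec_eq_iff forall_3 axis_def)
    then have "y = A' *v lift 0 1" using y(2) AA'(2) by metis
    then have "peval F y = 0" using 0 by (simp add: f_def)
    moreover have "y \<noteq> 0"
    proof
      assume "y = 0"
      then have "lift 0 1 $ 3 = 0" using y(2) ax by simp
      then show False by simp
    qed
    ultimately show False using Op(2) y(1) reduced_equation_pt_iff[OF F] by blast
  qed
  \<comment> \<open>Otherwise the point of \<open>C\<close> with these coordinates would be carried
    by the blow-up and the first-type steps to the first centre on \<open>P\<close>, which lies off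
    the image of \<open>C\<close>.\<close>
  have centre_r: "f (lift (h r *s r) (p r)) \<noteq> 0" if "N > 0"
  proof
    assume 0: "f (lift (h r *s r) (p r)) = 0"
    have ps0: "ps \<noteq> []" using ps(1) that by auto
    define y where "y = A' *v lift (h r *s r) (p r)"
    have Ay: "A *v y = lift (h r *s r) (p r)" by (simp add: y_def AA')
    have x: "h r *s r \<noteq> 0" using hr qs(3) by simp
    have hh: "h (h r *s r) = h r ^ Suc N" by (simp add: form_scale[OF h])
    have "y \<noteq> 0" using Ay lift_nonzero[OF x] by auto
    then have yC: "pt y \<in> C"
      using 0 reduced_equation_pt_iff[OF F] by (simp add: f_def y_def)
    have "biregular (blowup_plane A) O first_steps 1 rs = {(pt y, hpt (Suc N) (x, 1, h x * w - 0)) | y x w.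
        x \<noteq> 0 \<and> h x \<noteq> 0 \<and> 1 \<noteq> (0::complex) \<and> A *v y = lift x w}"
      unfolding first
      by (rule blowup_graph[OF A form_imp_homog[OF h], of 0]) (simp_all add: homog_def)
    moreover have "h (h r *s r) \<noteq> 0" using hr by (simp add: hh)
    ultimately have "(pt y, hpt (Suc N) (h r *s r, 1, h (h r *s r) * p r - 0)) \<in>
        biregular (blowup_plane A) O first_steps 1 rs"
      using x Ay one_neq_zero by blast
    \<comment> \<open>The scalars are \<open>h r\<close> on the base and \<open>h r ^ Suc N\<close>
      on the fibre. At \<open>r\<close> the form \<open>p\<close> reduces to the first centre, all
      later terms containing \<open>fib r\<close>.\<close>
    moreover have "hpt (Suc N) (r, 1, peval (hd ps) r) =
        hpt (Suc N) (h r *s r, 1, h (h r *s r) * p r - 0)"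
      using hr by (intro hpt_eqI[of "h r" "h r ^ Suc N"])
        (simp_all add: hh p_def centres_form_at[OF fib_rr ps0])
    ultimately have "second_centre (length ps) r (hd ps) \<in>
        (biregular (blowup_plane A) O first_steps 1 rs) `` C"
      using yC unfolding second_centre_def ps(1) by (metis ImageI)
    with cen[OF ps0] show False by (simp add: rs_def)
  qed
  interpret transformation f d N h l p
  proof
    show "\<exists>x. x \<noteq> 0 \<and> l x = 0" if "N > 0"
      using that qs(3) fib_rr by (auto simp: l_def)
    show "f (lift (h x *s x) (p x)) \<noteq> 0" if x: "x \<noteq> 0" and lx: "l x = 0" for x
    proof -
      \<comment> \<open>For \<open>N = 0\<close> the function \<open>l\<close> is constantly 1, so a
        zero of \<open>l\<close> forces \<open>N > 0\<close>.\<close>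
      have "N > 0" "fib r x = 0" using lx by (auto simp: l_def)
      then obtain c where c: "c \<noteq> 0" "x = c *s r"
        using fib_eq_0D[OF qs(3) x] by blast
      have "lift (h x *s x) (p x) = c ^ Suc N *s lift (h r *s r) (p r)"
        by (simp add: c(2) scale_lift form_scale[OF h] form_scale[OF p] mult_ac)
      then show ?thesis
        using c(1) centre_r[OF \<open>N > 0\<close>] by (simp add: form_scale[OF f] del: power_Suc)
    qed
  qed (use f F' f_centre h l p hr lnz in auto)
  have "first_steps 1 rs O second_steps r ps =
      graph 1 1 (\<lambda>x. h x * 1) (\<lambda>x. 1 * l x) (\<lambda>x. 1 * 0 + p x * 1)"
    unfolding first second_steps_eq[OF ps(2)] ps(1) l_def[symmetric] p_def[symmetric]
    by (rule graph_comp[of 0 _ N]) (use form_imp_homog[OF l] form_imp_homog[OF p] in \<open>simp_all add: homog_def\<close>)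
  then have eq: "graph 1 1 h l p = first_steps 1 rs O second_steps r ps"
    by simp
  have "T = biregular (blowup_plane A) O graph 1 1 h l p O (biregular (blowup_plane B))\<inverse>"
    by (simp only: T rs_def[symmetric] O_assoc eq)
  also have "\<dots> = {(pt y, pt z) | y z x w. x \<noteq> 0 \<and> h x \<noteq> 0 \<and> l x \<noteq> 0 \<and> A *v y = lift x w \<and>
      B *v z = lift (l x *s x) (h x * w - p x)}"
    by (rule cremona_graph[OF A B form_imp_homog[OF h] form_imp_homog[OF l]])
      (use form_imp_homog[OF p] in simp)
  finally have "pt z \<in> T `` C \<longleftrightarrow> base (B *v z) \<noteq> 0 \<and> h (base (B *v z)) \<noteq> 0 \<and>
      l (base (B *v z)) \<noteq> 0 \<and> g (B *v z) = 0" for z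
    using pt_in_image_iff[OF F f_def A' B'(2)] by simp
  moreover have "reduced f"
    unfolding f_def by (rule squarefree_imp_reduced[OF F'(3) A'])
  ultimately have "plane_curve_of_degree (zariski_closure (T `` C)) (d * (N + 1))"
    by (intro plane_curve_of_degree_closure[OF _ B'])
  then show ?thesis by (simp add: proper_transform_def N_def)
qed

end
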